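(* Let $N\ge2$ be an integer and let $f\in C(\mathbb{R},\mathbb{R})$, $F(t)=\int_0^tf(\tau)\,d\tau$, satisfy: $\lim_{t\to0}f(t)/t=0$; $F(t)/t^2$ is non-increasing on $(-\infty,0)$ and non-decreasing on $(0,+\infty)$; $F(t)\le F(|t|)$ for all $t\in\mathbb{R}$; and there exists $\zeta>0$ such that $F(\zeta)-2N\zeta^2>0$. Then there exists $m^*\in[0,\zeta^2)$ such that for all $m>m^*$ the infimum $E_m=\inf_{u\in S_m}I(u)$ is achieved by some positive Schwarz symmetric function $u\in S_m$ (that is, $I(u)=E_m$, $u(x)>0$ for all $x\in\mathbb{Z}^N$, and $u$ is Schwarz symmetric), where $S_m$ and $I$ are as defined in the context.
   Context: The lattice graph $\mathbb{Z}^N$ has vertex set $\{x=(x_1,\dots,x_N):x_i\in\mathbb{Z}\}$, and $x\sim y$ means $\sum_{i=1}^N|x_i-y_i|=1$. $\mu$ is the counting measure on $\mathbb{Z}^N$, so $\int_{\mathbb{Z}^N} g\,d\mu=\sum_{x\in\mathbb{Z}^N}g(x)$. $\ell^p(\mathbb{Z}^N)$ has its usual norm $\|\cdot\|_p$. For $u:\mathbb{Z}^N\to\mathbb{R}$, $$|\nabla u|(x)=\Big(\tfrac12\sum_{y\sim x}(u(y)-u(x))^2\Big)^{1/2}.$$ $H^1(\mathbb{Z}^N)$ is the completion of the finitely supported functions under the norm $\big(\tfrac12\sum_x\sum_{y\sim x}(u(y)-u(x))^2+\sum_x u(x)^2\big)^{1/2}$; it coincides with $\ell^2(\mathbb{Z}^N)$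 with equivalent norms. For $m>0$, $S_m=\{u\in H^1(\mathbb{Z}^N):\|u\|_2^2=m\}$. The functional is $$I(u)=\frac12\int_{\mathbb{Z}^N}|\nabla u|^2\,d\mu-\int_{\mathbb{Z}^N}F(u)\,d\mu,\qquad u\in H^1(\mathbb{Z}^N),$$ and $E_m=\inf_{u\in S_m}I(u)$. Schwarz symmetry. Let $C_0^+(\mathbb{Z}^N)$ be the set of admissible functions, i.e. functions $u:\mathbb{Z}^N\to[0,\infty)$ such that $\{x:u(x)>t\}$ is finite for every $t>0$. Let $R=R_{\mathbb{Z}^N}:C_0^+(\mathbb{Z}^N)\to C_0^+(\mathbb{Z}^N)$ denote the discrete Schwarz rearrangement operator on $\mathbb{Z}^N$ of Hajaiej, Han and Hua. A function $u\in C_0^+(\mathbb{Z}^N)$ is called Schwarz symmetric if $Ru=u$; $\mathcal{S}(\mathbb{Z}^N)$ denotes the set of Schwarz symmetric functions and $\mathcal{S}^p(\mathbb{Z}^N)=\mathcal{S}(\mathbb{Z}^N)\cap\ell^p(\mathbb{Z}^N)$. For the present purpose, $R$ is specified by the following known properties, which may be taken as given: (a) $R(Ru)=Ru$ for all $u\in C_0^+(\mathbb{Z}^N)$; (b) for every $g:[0,\infty)\to[0,\infty)$ with $g(0)=0$ and every $u\in C_0^+(\mathbb{Z}^N)$, $\sum_x g(u(x))=\sum_x g(Ru(x))$; (c) for every non-negative $u\in\ell^2(\mathbb{Z}^N)$, $\|\nabla (Ru)\|_2\le\|\nabla u\|_2$; (d) if $u_n\in\mathcal{S}(\mathbb{Z}^N)$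 converge pointwise to $u\in C_0^+(\mathbb{Z}^N)$, then $u\in\mathcal{S}(\mathbb{Z}^N)$; (e) for $1\le p<q<\infty$, every bounded sequence in $\mathcal{S}^p(\mathbb{Z}^N)$ (bounded in $\ell^p$) has a subsequence converging in $\ell^q(\mathbb{Z}^N)$. *)

theory Defs
  imports "HOL-Analysis.Analysis"
begin

section \<open>The lattice graph\<close>

text \<open>The lattice of dimension \<open>N\<close> is the type \<^typ>\<open>int ^ 'n\<close> with \<open>N = CARD('n)\<close>.\<close>

definition lattice_adj :: "int ^ 'n \<Rightarrow> int ^ 'n \<Rightarrow> bool" where
  "lattice_adj x y \<longleftrightarrow> (\<Sum>i\<in>UNIV. \<bar>x $ i - y $ i\<bar>) = 1"

lemma finite_lattice_neighbours: "finite {y :: int ^ 'n. lattice_adj y x}"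
proof -
  have "{y. lattice_adj y x} \<subseteq> vec_lambda ` (\<Pi>\<^sub>E i\<in>UNIV. {x $ i - 1..x $ i + 1})"
  proof
    fix y assume "y \<in> {y. lattice_adj y x}"
    then have s: "(\<Sum>i\<in>UNIV. \<bar>y $ i - x $ i\<bar>) = 1"
      by (simp add: lattice_adj_def)
    have "\<bar>y $ i - x $ i\<bar> \<le> 1" for i
      using member_le_sum[of i UNIV "\<lambda>i. \<bar>y $ i - x $ i\<bar>"] s by simp
    then have "y $ i \<in> {x $ i - 1..x $ i + 1}" for i
      by (smt (verit) atLeastAtMost_iff)
    then have "vec_nth y \<in> (\<Pi>\<^sub>E i\<in>UNIV. {x $ i - 1..x $ i + 1})"
      by (simp add: PiE_def)
    moreover have "y = vec_lambda (vec_nth y)" by simp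
    ultimately show "y \<in> vec_lambda ` (\<Pi>\<^sub>E i\<in>UNIV. {x $ i - 1..x $ i + 1})"
      by blast
  qed
  moreover have "finite (vec_lambda ` (\<Pi>\<^sub>E i\<in>UNIV. {x $ i - 1..x $ i + 1}))"
    by (intro finite_imageI finite_PiE) auto
  ultimately show ?thesis by (rule finite_subset)
qed

definition lattice_grad :: "(int ^ 'n \<Rightarrow> real) \<Rightarrow> int ^ 'n \<Rightarrow> real" where
  "lattice_grad u x = sqrt (1/2 * (\<Sum>y | lattice_adj y x. (u y - u x)\<^sup>2))"


section \<open>Function spaces\<close>

definition lp_space :: "real \<Rightarrow> ('a \<Rightarrow> real) set" where
  "lp_space p = {u. (\<lambda>x. \<bar>u x\<bar> powr p) summable_on UNIV}"

definition lp_norm :: "real \<Rightarrow> ('a \<Rightarrow> real) \<Rightarrow> real" where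
  "lp_norm p u = (\<Sum>\<^sub>\<infinity>x. \<bar>u x\<bar> powr p) powr (1 / p)"

definition h1_norm :: "(int ^ 'n \<Rightarrow> real) \<Rightarrow> real" where
  "h1_norm u =
    sqrt (1/2 * (\<Sum>\<^sub>\<infinity>x. \<Sum>y | lattice_adj y x. (u y - u x)\<^sup>2) + (\<Sum>\<^sub>\<infinity>x. (u x)\<^sup>2))"

text \<open>The completion of the finitely supported functions under \<open>h1_norm\<close>, realised as a
  space of functions: since \<open>\<bar>u x\<bar> \<le> h1_norm u\<close>, a Cauchy sequence of finitely supported
  functions converges pointwise, and its class in the completion is identified with its
  pointwise limit.\<close>

definition H1 :: "(int ^ 'n \<Rightarrow> real) set" where
  "H1 = {u. \<exists>\<phi> :: nat \<Rightarrow> int ^ 'n \<Rightarrow> real.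
      (\<forall>k. finite {x. \<phi> k x \<noteq> 0}) \<and>
      (\<forall>\<epsilon>>0. \<exists>K. \<forall>j\<ge>K. \<forall>k\<ge>K. h1_norm (\<lambda>x. \<phi> j x - \<phi> k x) < \<epsilon>) \<and>
      (\<forall>x. (\<lambda>k. \<phi> k x) \<longlonglongrightarrow> u x)}"


section \<open>The constrained minimisation problem\<close>

text \<open>The interval integral is signed, so this is the usual primitive also for \<open>t < 0\<close>.\<close>

definition primitive :: "(real \<Rightarrow> real) \<Rightarrow> real \<Rightarrow> real" where
  "primitive f t = (LBINT \<tau>=0..ereal t. f \<tau>)"

definition mass_sphere :: "real \<Rightarrow> (int ^ 'n \<Rightarrow> real) set" where
  "mass_sphere m = {u \<in> H1. (lp_norm 2 u)\<^sup>2 = m}"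

definition energy :: "(real \<Rightarrow> real) \<Rightarrow> (int ^ 'n \<Rightarrow> real) \<Rightarrow> real" where
  "energy f u = 1/2 * (\<Sum>\<^sub>\<infinity>x. (lattice_grad u x)\<^sup>2) - (\<Sum>\<^sub>\<infinity>x. primitive f (u x))"

text \<open>The infimum is taken in the extended reals, so that it is the true infimum without
  first knowing that the energy is bounded below. The dimension is passed as a type.\<close>

definition ground_energy :: "'n::finite itself \<Rightarrow> (real \<Rightarrow> real) \<Rightarrow> real \<Rightarrow> ereal" where
  "ground_energy _ f m = (INF u \<in> (mass_sphere m :: (int ^ 'n \<Rightarrow> real) set). ereal (energy f u))"


section \<open>Schwarz symmetry\<close>

definition admissible :: "('a \<Rightarrow> real) set" where
  "admissible = {u. (\<forall>x. 0 \<le> u x) \<and> (\<forall>t>0. finite {x. u x > t})}"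

definition schwarz_symmetric ::
    "((int ^ 'n \<Rightarrow> real) \<Rightarrow> (int ^ 'n \<Rightarrow> real)) \<Rightarrow> (int ^ 'n \<Rightarrow> real) \<Rightarrow> bool" where
  "schwarz_symmetric R u \<longleftrightarrow> u \<in> admissible \<and> R u = u"

text \<open>The discrete Schwarz rearrangement operator of Hajaiej, Han and Hua enters only through
  the following properties. Its values outside \<^const>\<open>admissible\<close> are irrelevant. The sums in
  \<open>equimeasurable\<close> may be infinite and are therefore taken in \<^typ>\<open>ennreal\<close>.\<close>

locale schwarz_rearrangement =
  fixes R :: "(int ^ 'n \<Rightarrow> real) \<Rightarrow> (int ^ 'n \<Rightarrow> real)"
  assumes maps_admissible: "u \<in> admissible \<Longrightarrow> R u \<in> admissible"
    and idempotent: "u \<in> admissible \<Longrightarrow> R (R u) = R u"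
    and equimeasurable:
      "\<lbrakk>\<And>t. 0 \<le> t \<Longrightarrow> 0 \<le> g t; g 0 = 0; u \<in> admissible\<rbrakk>
        \<Longrightarrow> (\<Sum>\<^sub>\<infinity>x. ennreal (g (u x))) = (\<Sum>\<^sub>\<infinity>x. ennreal (g (R u x)))"
    and polya_szego:
      "\<lbrakk>u \<in> lp_space 2; \<And>x. 0 \<le> u x\<rbrakk>
        \<Longrightarrow> lp_norm 2 (lattice_grad (R u)) \<le> lp_norm 2 (lattice_grad u)"
    and pointwise_closed:
      "\<lbrakk>\<And>k. schwarz_symmetric R (v k); u \<in> admissible; \<And>x. (\<lambda>k. v k x) \<longlonglongrightarrow> u x\<rbrakk>
        \<Longrightarrow> schwarz_symmetric R u"
    and compact_embedding:
      "\<lbrakk>1 \<le> p; p < q; \<And>k. schwarz_symmetric R (v k); \<And>k. v k \<in> lp_space p;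
        \<And>k. lp_norm p (v k) \<le> C\<rbrakk>
        \<Longrightarrow> \<exists>r w. strict_mono r \<and> w \<in> lp_space q \<and>
              (\<lambda>k. lp_norm q (\<lambda>x. v (r k) x - w x)) \<longlonglongrightarrow> 0"

end

theory Submission
  imports Defs
begin

text \<open>A minimising sequence may be taken Schwarz symmetric, and then has a subsequence converging
  in \<open>\<ell>\<^sup>3\<close>, hence uniformly, to some \<open>w\<close>. As \<open>F t = o(t\<^sup>2)\<close>, the sums of \<open>F\<close> converge, and Fatou's
  lemma gives \<open>energy f w \<le> E\<close> and mass at most \<open>m\<close>, where \<open>E\<close> is the infimum. Since \<open>F t / t\<^sup>2\<close> is
  non-decreasing, rescaling \<open>w\<close> by \<open>\<theta> \<ge> 1\<close> to mass \<open>m\<close> gives energy at most \<open>\<theta>\<^sup>2 * E\<close>. If \<open>E < 0\<close> this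
  forces \<open>\<theta> = 1\<close>. A point mass shows \<open>E < 0\<close> as soon as \<open>F (sqrt m) > N * m\<close>, which by continuity of
  \<open>F\<close> holds already for some \<open>m < \<zeta>\<^sup>2\<close>, and by monotonicity for all larger \<open>m\<close>.\<close>

section \<open>Sums over infinite sets\<close>

lemma has_sum_sum_finite:
  fixes f :: "'i \<Rightarrow> 'a \<Rightarrow> real"
  assumes "finite I" "\<And>i. i \<in> I \<Longrightarrow> (f i has_sum s i) A"
  shows "((\<lambda>x. \<Sum>i\<in>I. f i x) has_sum (\<Sum>i\<in>I. s i)) A"
  using assms by (induction I) (auto intro: has_sum_add)

lemma has_sum_diff_real:
  fixes f g :: "'a \<Rightarrow> real"
  assumes "(f has_sum a) A" "(g has_sum b) A"
  shows "((\<lambda>x. f x - g x) has_sum (a - b)) A"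
  using has_sum_add[OF assms(1) has_sum_uminusI[OF assms(2)]] by simp

lemma summable_on_le_real:
  fixes f g :: "'a \<Rightarrow> real"
  assumes "g summable_on A" "\<And>x. x \<in> A \<Longrightarrow> \<bar>f x\<bar> \<le> g x"
  shows "f summable_on A"
proof -
  have "(\<lambda>x. \<bar>f x\<bar>) summable_on A"
    by (rule summable_on_comparison_test[OF assms(1)]) (use assms(2) in auto)
  then show ?thesis
    using summable_on_iff_abs_summable_on_real by (metis (mono_tags) real_norm_def summable_on_cong)
qed

lemma summable_on_mult_real:
  fixes u v :: "'a \<Rightarrow> real"
  assumes "(\<lambda>x. (u x)\<^sup>2) summable_on A" "(\<lambda>x. (v x)\<^sup>2) summable_on A"
  shows "(\<lambda>x. u x * v x) summable_on A"
proof (rule summable_on_le_real)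
  show "(\<lambda>x. (u x)\<^sup>2 + (v x)\<^sup>2) summable_on A"
    using assms by (rule summable_on_add)
  fix x
  have "2 * (\<bar>u x\<bar> * \<bar>v x\<bar>) \<le> (u x)\<^sup>2 + (v x)\<^sup>2"
    using sum_squares_bound[of "\<bar>u x\<bar>" "\<bar>v x\<bar>"] by simp
  moreover have "0 \<le> \<bar>u x\<bar> * \<bar>v x\<bar>" by simp
  ultimately show "\<bar>u x * v x\<bar> \<le> (u x)\<^sup>2 + (v x)\<^sup>2"
    unfolding abs_mult by linarith
qed

lemma summable_on_square_add:
  fixes u v :: "'a \<Rightarrow> real"
  assumes "(\<lambda>x. (u x)\<^sup>2) summable_on A" "(\<lambda>x. (v x)\<^sup>2) summable_on A"
  shows "(\<lambda>x. (u x + v x)\<^sup>2) summable_on A"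
proof -
  have "(\<lambda>x. (u x)\<^sup>2 + (v x)\<^sup>2 + 2 * (u x * v x)) summable_on A"
    by (intro summable_on_add assms summable_on_cmult_right summable_on_mult_real)
  then show ?thesis
    by (simp add: power2_sum mult.assoc)
qed

lemma le_infsum_nonneg:
  fixes f :: "'a \<Rightarrow> real"
  assumes "f summable_on UNIV" "\<And>x. 0 \<le> f x"
  shows "f x \<le> infsum f UNIV"
  using finite_sum_le_infsum[OF assms(1), of "{x}"] assms(2) by simp

text \<open>Each finite partial sum passes to the limit, and the infinite sum is their supremum. The
  bound \<open>c k\<close> may vary with \<open>k\<close>: the bound on the gradient term along a
  minimising sequence only converges.\<close>

lemma infsum_fatou:
  fixes f :: "nat \<Rightarrow> 'a \<Rightarrow> real"
  assumes "\<And>k. f k summable_on UNIV" "\<And>k x. 0 \<le> f k x"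
    and lim: "\<And>x. (\<lambda>k. f k x) \<longlonglongrightarrow> g x"
    and bound: "\<And>k. infsum (f k) UNIV \<le> c k" "c \<longlonglongrightarrow> C"
  shows "g summable_on UNIV" "infsum g UNIV \<le> C"
proof -
  have nonneg: "0 \<le> g x" for x
    by (rule LIMSEQ_le_const[OF lim]) (use assms(2) in auto)
  have part: "sum g F \<le> C" if "finite F" for F
  proof (rule LIMSEQ_le)
    show "(\<lambda>k. sum (f k) F) \<longlonglongrightarrow> sum g F"
      by (intro tendsto_sum lim)
    show "c \<longlonglongrightarrow> C" by fact
    have "sum (f k) F \<le> c k" for k
      using finite_sum_le_infsum[OF assms(1) that, of k] assms(2) bound(1)[of k] by force
    then show "\<exists>N. \<forall>n\<ge>N. sum (f n) F \<le> c n" by blast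
  qed
  show s: "g summable_on UNIV"
    by (rule nonneg_bdd_above_summable_on) (use nonneg part in \<open>auto intro!: bdd_aboveI2\<close>)
  show "infsum g UNIV \<le> C"
    by (rule infsum_le_finite_sums[OF s]) (use part in auto)
qed

text \<open>Transfers equimeasurability from \<open>ennreal\<close> to real sums. Summability of
  \<open>g\<close> has to be recovered first, because a real \<open>infsum\<close> takes the default
  value 0 on a family that is not summable.\<close>

lemma infsum_ennreal_eq:
  fixes f g :: "'a \<Rightarrow> real"
  assumes f: "f summable_on UNIV" "\<And>x. 0 \<le> f x" and g: "\<And>x. 0 \<le> g x"
    and eq: "(\<Sum>\<^sub>\<infinity>x. ennreal (f x)) = (\<Sum>\<^sub>\<infinity>x. ennreal (g x))"
  shows "g summable_on UNIV" "infsum g UNIV = infsum f UNIV"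
proof -
  have conv: "(\<Sum>\<^sub>\<infinity>x. ennreal (h x)) = ennreal (infsum h UNIV)"
    if "h summable_on UNIV" "\<And>x. 0 \<le> h x" for h :: "'a \<Rightarrow> real"
  proof -
    have "(\<Sum>\<^sub>\<infinity>x. ennreal (h x)) = (SUP F\<in>{F. finite F \<and> F \<subseteq> UNIV}. \<Sum>x\<in>F. ennreal (h x))"
      by (rule nonneg_infsum_complete) auto
    also have "\<dots> = (SUP F\<in>{F. finite F \<and> F \<subseteq> UNIV}. ennreal (sum h F))"
      using that by (auto intro!: SUP_cong sum_ennreal)
    finally show ?thesis
      using infsum_nonneg_is_SUPREMUM_ennreal[of h UNIV] that by simp
  qed
  have "sum g F \<le> infsum f UNIV" if "finite F" for F
  proof -
    have "ennreal (sum g F) = (\<Sum>x\<in>F. ennreal (g x))"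
      using g by (simp add: sum_ennreal)
    also have "\<dots> \<le> (SUP F\<in>{F. finite F \<and> F \<subseteq> UNIV}. \<Sum>x\<in>F. ennreal (g x))"
      using that by (intro SUP_upper) auto
    also have "\<dots> = (\<Sum>\<^sub>\<infinity>x. ennreal (g x))"
      by (rule nonneg_infsum_complete[symmetric]) auto
    also have "\<dots> = ennreal (infsum f UNIV)"
      using conv[OF f] eq by simp
    finally show ?thesis
      by (simp add: ennreal_le_iff infsum_nonneg f)
  qed
  then show s: "g summable_on UNIV"
    by (intro nonneg_bdd_above_summable_on) (use g in \<open>auto intro!: bdd_aboveI2\<close>)
  have "ennreal (infsum g UNIV) = ennreal (infsum f UNIV)"
    using conv[OF f] conv[OF s] eq g by simp
  then show "infsum g UNIV = infsum f UNIV"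
    by (simp add: infsum_nonneg f g)
qed

section \<open>The adjacency operator and the Dirichlet energy\<close>

definition lattice_degree :: "'n::finite itself \<Rightarrow> nat" where
  "lattice_degree _ = card {d :: int ^ 'n. lattice_adj d 0}"

definition neighbour_sum :: "(int ^ 'n \<Rightarrow> real) \<Rightarrow> int ^ 'n \<Rightarrow> real" where
  "neighbour_sum u x = (\<Sum>y | lattice_adj y x. u y)"

lemma lattice_adj_iff_diff: "lattice_adj y x \<longleftrightarrow> lattice_adj (y - x) 0"
  by (simp add: lattice_adj_def)

lemma lattice_adj_uminus: "lattice_adj (- d) 0 \<longleftrightarrow> lattice_adj d 0"
  by (simp add: lattice_adj_def)

lemma lattice_adj_commute: "lattice_adj x y \<longleftrightarrow> lattice_adj y x"
  by (simp add: lattice_adj_def abs_minus_commute)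

text \<open>Writing neighbours as \<open>x + d\<close> makes the index set independent of
  \<open>x\<close>, so a sum over edges becomes a finite sum of sums of translates.\<close>

lemma sum_neighbours:
  fixes x :: "int ^ 'n"
  shows "(\<Sum>y | lattice_adj y x. g y) = (\<Sum>d | lattice_adj d 0. g (x + d))"
  by (rule sum.reindex_bij_witness[of _ "\<lambda>d. x + d" "\<lambda>y. y - x"])
     (auto simp: lattice_adj_iff_diff[of _ x])

lemma neighbour_sum_eq: "neighbour_sum u x = (\<Sum>d | lattice_adj d 0. u (x + d))"
  unfolding neighbour_sum_def by (rule sum_neighbours)

lemma bij_translation: "bij_betw (\<lambda>x. x + d) UNIV (UNIV :: 'a::ab_group_add set)"
  by (rule bij_betwI[of _ _ _ "\<lambda>x. x - d"]) auto

text \<open>Every translate of \<open>v\<close> has the same sum \<open>S\<close>, and there is one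
  translate for each neighbour of 0.\<close>

lemma has_sum_neighbour_sum:
  fixes v :: "int ^ 'n \<Rightarrow> real" and S :: real
  assumes "(v has_sum S) UNIV"
  shows "(neighbour_sum v has_sum (lattice_degree TYPE('n) * S)) UNIV"
proof -
  have "((\<lambda>x. \<Sum>d | lattice_adj d 0. v (x + d)) has_sum (\<Sum>d | lattice_adj (d :: int ^ 'n) 0. S)) UNIV"
    by (rule has_sum_sum_finite[OF finite_lattice_neighbours])
       (rule has_sum_reindex_bij_betw[OF bij_translation, THEN iffD2, OF assms])
  then show ?thesis
    unfolding neighbour_sum_eq[abs_def] lattice_degree_def by simp
qed

lemma card_neighbours: "card {y. lattice_adj y (x :: int ^ 'n)} = lattice_degree TYPE('n)"
  using sum_neighbours[of "\<lambda>_. 1::nat" x] by (simp add: lattice_degree_def)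

text \<open>Cauchy-Schwarz over the neighbours of \<open>x\<close>. Summed over \<open>x\<close>, it
  shows that the adjacency operator is bounded on \<open>\<ell>\<^sup>2\<close>.\<close>

lemma neighbour_sum_square_le:
  fixes u :: "int ^ 'n \<Rightarrow> real"
  shows "(neighbour_sum u x)\<^sup>2 \<le> lattice_degree TYPE('n) * neighbour_sum (\<lambda>y. (u y)\<^sup>2) x"
  using sum_squared_le_sum_of_squares[of u "{y. lattice_adj y x}"]
  by (simp add: neighbour_sum_def card_neighbours mult.commute)

lemma neighbour_sum_square_summable:
  fixes u :: "int ^ 'n \<Rightarrow> real"
  assumes "(\<lambda>x. (u x)\<^sup>2) summable_on UNIV"
  shows "(\<lambda>x. (neighbour_sum u x)\<^sup>2) summable_on UNIV"
proof (rule summable_on_comparison_test)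
  show "(\<lambda>x. lattice_degree TYPE('n) * neighbour_sum (\<lambda>y. (u y)\<^sup>2) x) summable_on UNIV"
    using has_sum_neighbour_sum assms
    by (intro summable_on_cmult_right) (auto simp: summable_on_def)
qed (use neighbour_sum_square_le in auto)

text \<open>For a fixed offset \<open>d\<close>, translation moves the shift from one factor to the
  other and turns \<open>d\<close> into \<open>- d\<close>; the set of offsets is invariant under
  this change of sign.\<close>

lemma neighbour_sum_symmetric:
  fixes u v :: "int ^ 'n \<Rightarrow> real"
  assumes "(\<lambda>x. (u x)\<^sup>2) summable_on UNIV" "(\<lambda>x. (v x)\<^sup>2) summable_on UNIV"
  shows "(\<Sum>\<^sub>\<infinity>x. u x * neighbour_sum v x) = (\<Sum>\<^sub>\<infinity>x. v x * neighbour_sum u x)"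
proof -
  define s where "s d = (\<Sum>\<^sub>\<infinity>x. u x * v (x + d))" for d
  have shift: "(\<lambda>x. (w (x + d))\<^sup>2) summable_on UNIV" if "(\<lambda>x. (w x)\<^sup>2) summable_on UNIV"
    for w and d :: "int ^ 'n"
    using that by (rule summable_on_reindex_bij_betw[OF bij_translation, THEN iffD2])
  have s: "((\<lambda>x. u x * v (x + d)) has_sum s d) UNIV" for d
    unfolding s_def
    by (intro has_sum_infsum summable_on_mult_real assms shift)
  have 1: "((\<lambda>x. \<Sum>d | lattice_adj d 0. u x * v (x + d)) has_sum (\<Sum>d | lattice_adj d 0. s d)) UNIV"
    by (intro has_sum_sum_finite finite_lattice_neighbours s)
  have "((\<lambda>x. v x * u (x + d)) has_sum s (- d)) UNIV" for d
  proof -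
    have "((\<lambda>x. u (x + d) * v (x + d + - d)) has_sum s (- d)) UNIV"
      using s[of "- d"] by (rule has_sum_reindex_bij_betw[OF bij_translation, THEN iffD2])
    then show ?thesis by (simp add: mult.commute)
  qed
  then have 2: "((\<lambda>x. \<Sum>d | lattice_adj d 0. v x * u (x + d)) has_sum (\<Sum>d | lattice_adj d 0. s (- d))) UNIV"
    by (intro has_sum_sum_finite finite_lattice_neighbours)
  have "(\<Sum>d | lattice_adj d 0. s (- d)) = (\<Sum>d | lattice_adj d 0. s d)"
    by (rule sum.reindex_bij_witness[of _ uminus uminus]) (auto simp: lattice_adj_uminus)
  with infsumI[OF 1] infsumI[OF 2] show ?thesis
    by (simp add: neighbour_sum_eq sum_distrib_left)
qed

lemma neighbour_sum_mult_summable: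
  fixes u v :: "int ^ 'n \<Rightarrow> real"
  assumes "(\<lambda>x. (u x)\<^sup>2) summable_on UNIV" "(\<lambda>x. (v x)\<^sup>2) summable_on UNIV"
  shows "(\<lambda>x. u x * neighbour_sum v x) summable_on UNIV"
  by (intro summable_on_mult_real neighbour_sum_square_summable assms)

lemma lattice_grad_square:
  fixes u :: "int ^ 'n \<Rightarrow> real"
  shows "(lattice_grad u x)\<^sup>2 = 1/2 * (\<Sum>y | lattice_adj y x. (u y - u x)\<^sup>2)"
  by (simp add: lattice_grad_def sum_nonneg)

text \<open>Expanding the squares, the terms in \<open>u y\<close> and those in \<open>u x\<close>
  each contribute half of degree times mass, and the cross terms form the adjacency quadratic form.
  At fixed mass only this form varies, which is what makes the later energy comparison
  short.\<close>

lemma has_sum_lattice_grad_square: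
  fixes u :: "int ^ 'n \<Rightarrow> real"
  assumes "(\<lambda>x. (u x)\<^sup>2) summable_on UNIV"
  shows "((\<lambda>x. (lattice_grad u x)\<^sup>2) has_sum
    (lattice_degree TYPE('n) * (\<Sum>\<^sub>\<infinity>x. (u x)\<^sup>2) - (\<Sum>\<^sub>\<infinity>x. u x * neighbour_sum u x))) UNIV"
proof -
  let ?D = "real (lattice_degree TYPE('n))" and ?S = "\<Sum>\<^sub>\<infinity>x. (u x)\<^sup>2"
  have "(lattice_grad u x)\<^sup>2
      = 1/2 * neighbour_sum (\<lambda>y. (u y)\<^sup>2) x + ?D / 2 * (u x)\<^sup>2 - u x * neighbour_sum u x" for x
  proof -
    have "(\<Sum>y | lattice_adj y x. (u y - u x)\<^sup>2)
        = (\<Sum>y | lattice_adj y x. (u y)\<^sup>2 + (u x)\<^sup>2 - 2 * u x * u y)"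
      by (intro sum.cong refl) (simp add: power2_diff mult.assoc mult.commute[of "u x"])
    also have "\<dots> = neighbour_sum (\<lambda>y. (u y)\<^sup>2) x + ?D * (u x)\<^sup>2 - 2 * u x * neighbour_sum u x"
      unfolding neighbour_sum_def sum_distrib_left sum_subtractf sum.distrib
      by (simp add: card_neighbours)
    finally show ?thesis
      unfolding lattice_grad_square by simp
  qed
  moreover have "((\<lambda>x. 1/2 * neighbour_sum (\<lambda>y. (u y)\<^sup>2) x + ?D / 2 * (u x)\<^sup>2 - u x * neighbour_sum u x)
     has_sum (1/2 * (?D * ?S) + ?D / 2 * ?S - (\<Sum>\<^sub>\<infinity>x. u x * neighbour_sum u x))) UNIV"
    using assms
    by (intro has_sum_diff_real has_sum_add has_sum_cmult_right has_sum_neighbour_sum has_sum_infsum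
        neighbour_sum_mult_summable)
  moreover have "1/2 * (?D * ?S) + ?D / 2 * ?S = ?D * ?S"
    by simp
  ultimately show ?thesis
    by simp
qed

lemmas lattice_grad_summable = has_sum_imp_summable[OF has_sum_lattice_grad_square]
lemmas infsum_lattice_grad_square = infsumI[OF has_sum_lattice_grad_square]

text \<open>Half of a squared difference is at most the sum of the two squares. This yields the
  equivalence of the \<open>H1\<close> and \<open>\<ell>\<^sup>2\<close> norms.\<close>

lemma infsum_lattice_grad_square_le:
  fixes u :: "int ^ 'n \<Rightarrow> real"
  assumes "(\<lambda>x. (u x)\<^sup>2) summable_on UNIV"
  shows "(\<Sum>\<^sub>\<infinity>x. (lattice_grad u x)\<^sup>2) \<le> 2 * lattice_degree TYPE('n) * (\<Sum>\<^sub>\<infinity>x. (u x)\<^sup>2)"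
proof -
  let ?D = "real (lattice_degree TYPE('n))" and ?S = "\<Sum>\<^sub>\<infinity>x. (u x)\<^sup>2"
  have "((\<lambda>x. neighbour_sum (\<lambda>y. (u y)\<^sup>2) x + ?D * (u x)\<^sup>2) has_sum (?D * ?S + ?D * ?S)) UNIV"
    using assms
    by (intro has_sum_add has_sum_cmult_right has_sum_neighbour_sum has_sum_infsum)
  then have sum: "((\<lambda>x. neighbour_sum (\<lambda>y. (u y)\<^sup>2) x + ?D * (u x)\<^sup>2) has_sum (2 * ?D * ?S)) UNIV"
    by (simp add: mult.assoc)
  have le: "(lattice_grad u x)\<^sup>2 \<le> neighbour_sum (\<lambda>y. (u y)\<^sup>2) x + ?D * (u x)\<^sup>2" for x
  proof -
    have "1/2 * (u y - u x)\<^sup>2 \<le> (u y)\<^sup>2 + (u x)\<^sup>2" for y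
      using sum_squares_bound[of "u y" "- u x"] by (simp add: power2_diff)
    then have "(\<Sum>y | lattice_adj y x. 1/2 * (u y - u x)\<^sup>2) \<le> (\<Sum>y | lattice_adj y x. (u y)\<^sup>2 + (u x)\<^sup>2)"
      by (intro sum_mono) auto
    then show ?thesis
      by (simp add: lattice_grad_square neighbour_sum_def sum.distrib card_neighbours sum_distrib_left)
  qed
  show ?thesis
    using has_sum_mono[OF has_sum_infsum[OF lattice_grad_summable[OF assms]] sum] le by simp
qed

text \<open>Taking moduli shrinks every difference along an edge, by the reverse triangle
  inequality.\<close>

lemma infsum_lattice_grad_abs_le:
  fixes u :: "int ^ 'n \<Rightarrow> real"
  assumes "(\<lambda>x. (u x)\<^sup>2) summable_on UNIV"
  shows "(\<Sum>\<^sub>\<infinity>x. (lattice_grad (\<lambda>x. \<bar>u x\<bar>) x)\<^sup>2) \<le> (\<Sum>\<^sub>\<infinity>x. (lattice_grad u x)\<^sup>2)"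
proof (rule infsum_mono)
  show "(lattice_grad (\<lambda>x. \<bar>u x\<bar>) x)\<^sup>2 \<le> (lattice_grad u x)\<^sup>2" for x
    unfolding lattice_grad_square
    by (intro mult_left_mono sum_mono) (auto simp: abs_le_square_iff[symmetric] intro: abs_triangle_ineq3)
qed (use assms in \<open>auto intro!: lattice_grad_summable\<close>)

section \<open>Connectedness and degree of the lattice\<close>

lemma lattice_adj_add_axis:
  fixes x :: "int ^ 'n"
  assumes "\<bar>s\<bar> = 1"
  shows "lattice_adj (x + axis i s) x"
proof -
  have "(\<Sum>j\<in>UNIV. \<bar>axis i s $ j\<bar>) = (\<Sum>j\<in>UNIV. if j = i then \<bar>s\<bar> else 0)"
    by (intro sum.cong) (auto simp: axis_def)
  then show ?thesis
    using assms by (simp add: lattice_adj_def)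
qed

text \<open>Connectedness in the form of an induction principle, proved by induction on the
  \<open>\<ell>\<^sup>1\<close> distance from \<open>a\<close> to \<open>b\<close>.\<close>

lemma lattice_connected:
  fixes a b :: "int ^ 'n"
  assumes "P a" and step: "\<And>x y. P x \<Longrightarrow> lattice_adj y x \<Longrightarrow> P y"
  shows "P b"
proof -
  have "P a \<Longrightarrow> P b" if "(\<Sum>j\<in>UNIV. \<bar>b $ j - a $ j\<bar>) = int n" for n a
    using that
  proof (induction n arbitrary: a)
    case 0
    then have "b = a"
      by (simp add: sum_nonneg_eq_0_iff vec_eq_iff)
    with 0 show ?case by simp
  next
    case (Suc n)
    have "\<exists>i. b $ i \<noteq> a $ i"
      using Suc.prems(2) by (rule contrapos_pp) simp
    then obtain i where i: "b $ i \<noteq> a $ i" by blast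
    \<comment> \<open>The unit step towards \<open>b\<close> in a coordinate where \<open>a\<close>
      and \<open>b\<close> differ; it lowers the distance by exactly one.\<close>
    define s where "s = sgn (b $ i - a $ i)"
    have "(\<Sum>j\<in>UNIV. \<bar>b $ j - (a + axis i s) $ j\<bar>) = (\<Sum>j\<in>UNIV. \<bar>b $ j - a $ j\<bar> - (if j = i then 1 else 0))"
      using i by (intro sum.cong) (auto simp: axis_def s_def sgn_if)
    then have "(\<Sum>j\<in>UNIV. \<bar>b $ j - (a + axis i s) $ j\<bar>) = int n"
      using Suc.prems by (simp add: sum_subtractf)
    moreover have "P (a + axis i s)"
      using Suc.prems(1) i by (intro step[OF _ lattice_adj_add_axis]) (auto simp: s_def sgn_if)
    ultimately show ?case by (rule Suc.IH[rotated])
  qed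
  moreover have "(\<Sum>j\<in>UNIV. \<bar>b $ j - a $ j\<bar>) = int (nat (\<Sum>j\<in>UNIV. \<bar>b $ j - a $ j\<bar>))"
    by (simp add: sum_nonneg)
  ultimately show ?thesis using assms(1) by blast
qed

text \<open>An integer vector of \<open>\<ell>\<^sup>1\<close> norm one has a single nonzero
  coordinate, and that coordinate is 1 or -1.\<close>

lemma lattice_degree_le: "lattice_degree TYPE('n) \<le> 2 * CARD('n::finite)"
proof -
  have "{d :: int ^ 'n. lattice_adj d 0} \<subseteq> range (\<lambda>i. axis i 1) \<union> range (\<lambda>i. axis i (- 1))"
  proof
    fix d :: "int ^ 'n" assume "d \<in> {d. lattice_adj d 0}"
    then have s: "(\<Sum>j\<in>UNIV. \<bar>d $ j\<bar>) = 1"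
      by (simp add: lattice_adj_def)
    then have "\<exists>i. d $ i \<noteq> 0"
      by (rule contrapos_pp) simp
    then obtain i where i: "d $ i \<noteq> 0" by blast
    have "(\<Sum>j\<in>UNIV. \<bar>d $ j\<bar>) = \<bar>d $ i\<bar> + (\<Sum>j\<in>UNIV - {i}. \<bar>d $ j\<bar>)"
      by (simp add: sum.remove)
    moreover have "0 \<le> (\<Sum>j\<in>UNIV - {i}. \<bar>d $ j\<bar>)"
      by (simp add: sum_nonneg)
    ultimately have "\<bar>d $ i\<bar> = 1" "(\<Sum>j\<in>UNIV - {i}. \<bar>d $ j\<bar>) = 0"
      using s i by linarith+
    then have "d = axis i (d $ i)"
      by (auto simp: sum_nonneg_eq_0_iff vec_eq_iff axis_def)
    moreover have "d $ i = 1 \<or> d $ i = - 1"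
      using \<open>\<bar>d $ i\<bar> = 1\<close> by linarith
    ultimately show "d \<in> range (\<lambda>i. axis i 1) \<union> range (\<lambda>i. axis i (- 1))"
      by (metis UnI1 UnI2 rangeI)
  qed
  then have "lattice_degree TYPE('n)
      \<le> card (range (\<lambda>i :: 'n. axis i (1::int)) \<union> range (\<lambda>i :: 'n. axis i (- 1 :: int)))"
    unfolding lattice_degree_def by (intro card_mono) auto
  also have "\<dots> \<le> card (range (\<lambda>i :: 'n. axis i (1::int))) + card (range (\<lambda>i :: 'n. axis i (- 1 :: int)))"
    by (rule card_Un_le)
  also have "\<dots> \<le> CARD('n) + CARD('n)"
    by (intro add_mono card_image_le) auto
  finally show ?thesis by simp
qed

section \<open>The spaces \<open>H1\<close> and \<open>\<ell>\<^sup>2\<close>\<close>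

lemma lp_norm_2_square: "(lp_norm 2 u)\<^sup>2 = (\<Sum>\<^sub>\<infinity>x. (u x)\<^sup>2)"
  by (simp add: lp_norm_def powr_half_sqrt infsum_nonneg)

lemma lp_space_2_iff: "u \<in> lp_space 2 \<longleftrightarrow> (\<lambda>x. (u x)\<^sup>2) summable_on UNIV"
  by (simp add: lp_space_def)

lemma lp_norm_nonneg: "0 \<le> lp_norm p u"
  by (simp add: lp_norm_def)

lemma h1_norm_square:
  fixes u :: "int ^ 'n \<Rightarrow> real"
  assumes "(\<lambda>x. (u x)\<^sup>2) summable_on UNIV"
  shows "(h1_norm u)\<^sup>2 = (\<Sum>\<^sub>\<infinity>x. (lattice_grad u x)\<^sup>2) + (\<Sum>\<^sub>\<infinity>x. (u x)\<^sup>2)"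
proof -
  have "1/2 * (\<Sum>\<^sub>\<infinity>x. \<Sum>y | lattice_adj y x. (u y - u x)\<^sup>2) = (\<Sum>\<^sub>\<infinity>x. (lattice_grad u x)\<^sup>2)"
    by (simp only: lattice_grad_square infsum_cmult_right')
  then show ?thesis
    by (simp add: h1_norm_def infsum_nonneg)
qed

lemma square_summable_finite_support:
  fixes u :: "'a \<Rightarrow> real"
  assumes "finite {x. u x \<noteq> 0}"
  shows "(\<lambda>x. (u x)\<^sup>2) summable_on UNIV"
  using has_sum_finite_neutralI[OF assms, of UNIV "\<lambda>x. (u x)\<^sup>2"] has_sum_imp_summable by fastforce


text \<open>From some index \<open>K\<close> on, the approximants differ from
  \<open>\<phi> K\<close> by at most 1 in \<open>\<ell>\<^sup>2\<close>. Fatou puts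
  \<open>u - \<phi> K\<close> into \<open>\<ell>\<^sup>2\<close>, and \<open>\<phi> K\<close> has
  finite support.\<close>

lemma H1_imp_square_summable:
  fixes u :: "int ^ 'n \<Rightarrow> real"
  assumes "u \<in> H1"
  shows "(\<lambda>x. (u x)\<^sup>2) summable_on UNIV"
proof -
  obtain \<phi> :: "nat \<Rightarrow> int ^ 'n \<Rightarrow> real" where fin: "\<And>k. finite {x. \<phi> k x \<noteq> 0}"
    and cauchy: "\<And>\<epsilon>. \<epsilon> > 0 \<Longrightarrow> \<exists>K. \<forall>j\<ge>K. \<forall>k\<ge>K. h1_norm (\<lambda>x. \<phi> j x - \<phi> k x) < \<epsilon>"
    and lim: "\<And>x. (\<lambda>k. \<phi> k x) \<longlonglongrightarrow> u x"
    using assms unfolding H1_def by blast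
  obtain K where K: "\<And>j k. j \<ge> K \<Longrightarrow> k \<ge> K \<Longrightarrow> h1_norm (\<lambda>x. \<phi> j x - \<phi> k x) < 1"
    using cauchy[of 1] by auto
  have sq: "(\<lambda>x. (\<phi> j x - \<phi> k x)\<^sup>2) summable_on UNIV" for j k
    by (intro square_summable_finite_support finite_subset[OF _ finite_UnI[OF fin[of j] fin[of k]]]) auto
  have bound: "(\<Sum>\<^sub>\<infinity>x. (\<phi> (k + K) x - \<phi> K x)\<^sup>2) \<le> 1" for k
  proof -
    have "(h1_norm (\<lambda>x. \<phi> (k + K) x - \<phi> K x))\<^sup>2 \<le> 1\<^sup>2"
      using K[of "k + K" K] by (intro power_mono) (auto simp: h1_norm_def infsum_nonneg sum_nonneg)
    moreover have "0 \<le> (\<Sum>\<^sub>\<infinity>x. (lattice_grad (\<lambda>x. \<phi> (k + K) x - \<phi> K x) x)\<^sup>2)"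
      by (simp add: infsum_nonneg)
    ultimately show ?thesis
      using h1_norm_square[OF sq[of "k + K" K]] by simp
  qed
  have "(\<lambda>x. (u x - \<phi> K x)\<^sup>2) summable_on UNIV"
  proof (rule infsum_fatou(1)[where c = "\<lambda>_. 1"])
    show "(\<lambda>k. (\<phi> (k + K) x - \<phi> K x)\<^sup>2) \<longlonglongrightarrow> (u x - \<phi> K x)\<^sup>2" for x
      by (intro tendsto_intros LIMSEQ_ignore_initial_segment lim)
  qed (use sq bound in \<open>auto intro: tendsto_const\<close>)
  from summable_on_square_add[OF this square_summable_finite_support[OF fin[of K]]] show ?thesis
    by simp
qed

text \<open>The approximants are the truncations of \<open>u\<close> along an enumeration of the
  countable lattice. Their differences are controlled by tails of the sum of squares.\<close>

lemma square_summable_imp_H1: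
  fixes u :: "int ^ 'n \<Rightarrow> real"
  assumes u: "(\<lambda>x. (u x)\<^sup>2) summable_on UNIV"
  shows "u \<in> H1"
proof -
  define A :: "nat \<Rightarrow> (int ^ 'n) set" where "A k = {x. to_nat x < k}" for k
  define \<phi> where "\<phi> k x = (if x \<in> A k then u x else 0)" for k x
  have finA: "finite (A k)" for k
    by (rule inj_on_finite[of to_nat _ "{..<k}"]) (auto simp: A_def intro: inj_on_subset[OF inj_to_nat])
  have fin: "finite {x. \<phi> k x \<noteq> 0}" for k
    by (rule finite_subset[OF _ finA[of k]]) (auto simp: \<phi>_def)
  have sq: "(\<lambda>x. (\<phi> j x - \<phi> k x)\<^sup>2) summable_on UNIV" for j k
    by (intro square_summable_finite_support finite_subset[OF _ finite_UnI[OF fin[of j] fin[of k]]]) auto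
  have lim: "(\<lambda>k. \<phi> k x) \<longlonglongrightarrow> u x" for x
  proof (rule tendsto_eventually)
    show "\<forall>\<^sub>F k in sequentially. \<phi> k x = u x"
      using eventually_gt_at_top[of "to_nat x"] by eventually_elim (simp add: \<phi>_def A_def)
  qed
  have cauchy: "\<exists>K. \<forall>j\<ge>K. \<forall>k\<ge>K. h1_norm (\<lambda>x. \<phi> j x - \<phi> k x) < \<epsilon>" if eps: "\<epsilon> > 0" for \<epsilon>
  proof -
    \<comment> \<open>The factor comparing the squared \<open>h1_norm\<close> with the squared
      \<open>\<ell>\<^sup>2\<close> norm. The tolerance chosen next leaves half of
      \<open>\<epsilon>\<^sup>2\<close>, so the final inequality is strict.\<close>
    define c where "c = 2 * real (lattice_degree TYPE('n)) + 1"
    have c: "c > 0" by (simp add: c_def add_nonneg_pos)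
    obtain G where G: "finite G" "dist (\<Sum>x\<in>G. (u x)\<^sup>2) (\<Sum>\<^sub>\<infinity>x. (u x)\<^sup>2) \<le> \<epsilon>\<^sup>2 / (2 * c)"
      using infsum_finite_approximation[OF u, of "\<epsilon>\<^sup>2 / (2 * c)"] eps c by auto
    obtain K where K: "to_nat ` G \<subseteq> {..<K}"
      using G(1) finite_nat_iff_bounded by blast
    \<comment> \<open>The sum of squares outside \<open>G\<close>. For indices beyond
      \<open>K\<close> both truncations agree with \<open>u\<close> on \<open>G\<close>, so their
      difference lives in this tail.\<close>
    have tail: "((\<lambda>x. (u x)\<^sup>2 - (if x \<in> G then (u x)\<^sup>2 else 0)) has_sum
        ((\<Sum>\<^sub>\<infinity>x. (u x)\<^sup>2) - (\<Sum>x\<in>G. (u x)\<^sup>2))) UNIV"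
      by (intro has_sum_diff_real has_sum_infsum u has_sum_finite_neutralI[OF G(1)]) auto
    have "h1_norm (\<lambda>x. \<phi> j x - \<phi> k x) < \<epsilon>" if jk: "j \<ge> K" "k \<ge> K" for j k
    proof -
      have "(\<Sum>\<^sub>\<infinity>x. (\<phi> j x - \<phi> k x)\<^sup>2) \<le> (\<Sum>\<^sub>\<infinity>x. (u x)\<^sup>2) - (\<Sum>x\<in>G. (u x)\<^sup>2)"
      proof (rule has_sum_mono[OF has_sum_infsum[OF sq] tail])
        fix x
        have "x \<in> A j" "x \<in> A k" if "x \<in> G"
          using that K jk by (auto simp: A_def)
        then show "(\<phi> j x - \<phi> k x)\<^sup>2 \<le> (u x)\<^sup>2 - (if x \<in> G then (u x)\<^sup>2 else 0)"
          by (auto simp: \<phi>_def)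
      qed
      also have "\<dots> \<le> \<epsilon>\<^sup>2 / (2 * c)"
        using G(2) by (simp add: dist_real_def)
      finally have "(\<Sum>\<^sub>\<infinity>x. (\<phi> j x - \<phi> k x)\<^sup>2) \<le> \<epsilon>\<^sup>2 / (2 * c)" .
      then have "c * (\<Sum>\<^sub>\<infinity>x. (\<phi> j x - \<phi> k x)\<^sup>2) \<le> \<epsilon>\<^sup>2 / 2"
        using c by (simp add: field_simps)
      moreover have "(h1_norm (\<lambda>x. \<phi> j x - \<phi> k x))\<^sup>2 \<le> c * (\<Sum>\<^sub>\<infinity>x. (\<phi> j x - \<phi> k x)\<^sup>2)"
        unfolding h1_norm_square[OF sq] c_def distrib_right
        using infsum_lattice_grad_square_le[OF sq[of j k]] by simp
      moreover have "0 < \<epsilon>\<^sup>2" using \<open>\<epsilon> > 0\<close> by simp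
      ultimately have "(h1_norm (\<lambda>x. \<phi> j x - \<phi> k x))\<^sup>2 < \<epsilon>\<^sup>2" by linarith
      then show ?thesis
        by (rule power2_less_imp_less) (use eps in simp)
    qed
    then show ?thesis by blast
  qed
  show ?thesis
    unfolding H1_def using fin lim cauchy by blast
qed

text \<open>From here on the completion is out of sight: all arguments take place in
  \<open>\<ell>\<^sup>2\<close>.\<close>

lemma mass_sphere_iff:
  fixes u :: "int ^ 'n \<Rightarrow> real"
  shows "u \<in> mass_sphere m \<longleftrightarrow> (\<lambda>x. (u x)\<^sup>2) summable_on UNIV \<and> (\<Sum>\<^sub>\<infinity>x. (u x)\<^sup>2) = m"
  using H1_imp_square_summable square_summable_imp_H1
  by (auto simp: mass_sphere_def lp_norm_2_square)

section \<open>The nonlinearity\<close>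

locale nls_nonlinearity =
  fixes f :: "real \<Rightarrow> real"
  assumes continuous: "continuous_on UNIV f"
    and vanishing: "((\<lambda>t. f t / t) \<longlongrightarrow> 0) (at 0)"
    and antimono: "antimono_on {..<0} (\<lambda>t. primitive f t / t\<^sup>2)"
    and mono: "mono_on {0<..} (\<lambda>t. primitive f t / t\<^sup>2)"
    and le_abs: "\<And>t. primitive f t \<le> primitive f \<bar>t\<bar>"
begin

abbreviation "F \<equiv> primitive f"

lemma F_0 [simp]: "F 0 = 0"
  by (simp add: primitive_def flip: zero_ereal_def)

lemma F_deriv: "(F has_real_derivative f t) (at t)"
proof -
  \<comment> \<open>The symmetric interval contains 0, and the added 1 puts \<open>t\<close> in its
    interior, so the one-sided notion of derivative on the interval is the full derivative.\<close>
  let ?a = "\<bar>t\<bar> + 1"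
  have "((\<lambda>u. LBINT y=ereal 0..ereal u. f y) has_vector_derivative f t) (at t within {- ?a..?a})"
    by (rule interval_integral_FTC2) (auto intro: continuous_on_subset[OF continuous])
  moreover have "at t within {- ?a..?a} = at t"
    by (rule at_within_Icc_at) auto
  ultimately show ?thesis
    by (simp add: has_real_derivative_iff_has_vector_derivative primitive_def[abs_def] zero_ereal_def)
qed

lemma F_isCont: "isCont F t"
  using F_deriv by (rule DERIV_isCont)

lemma F_mvt:
  assumes "a < b"
  obtains c where "a < c" "c < b" "F b - F a = (b - a) * f c"
  using MVT2[OF assms, of F f] F_deriv by blast

text \<open>By the mean value theorem \<open>F t\<close> is \<open>t * f c\<close> with
  \<open>c\<close> between 0 and \<open>t\<close>, and there \<open>f c\<close> is at most
  \<open>\<epsilon> * \<bar>c\<bar>\<close> in modulus.\<close>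

lemma F_small:
  assumes "\<epsilon> > 0"
  obtains \<delta> where "\<delta> > 0" "\<And>t. \<bar>t\<bar> < \<delta> \<Longrightarrow> \<bar>F t\<bar> \<le> \<epsilon> * t\<^sup>2"
proof -
  obtain \<delta> where \<delta>: "\<delta> > 0" and lt: "\<And>t. t \<noteq> 0 \<Longrightarrow> \<bar>t\<bar> < \<delta> \<Longrightarrow> \<bar>f t / t\<bar> < \<epsilon>"
    using LIM_D[OF vanishing assms] by auto
  have "\<bar>F t\<bar> \<le> \<epsilon> * t\<^sup>2" if "\<bar>t\<bar> < \<delta>" "t \<noteq> 0" for t
  proof -
    obtain c where c: "\<bar>c\<bar> \<le> \<bar>t\<bar>" "c \<noteq> 0" "\<bar>F t\<bar> = \<bar>t\<bar> * \<bar>f c\<bar>"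
    proof (cases "t > 0")
      case True
      then obtain c where "0 < c" "c < t" "F t - F 0 = (t - 0) * f c" by (rule F_mvt)
      then show ?thesis using that[of c] by (simp add: abs_mult)
    next
      case False
      then have "t < 0" using \<open>t \<noteq> 0\<close> by simp
      then obtain c where "t < c" "c < 0" "F 0 - F t = (0 - t) * f c" by (rule F_mvt)
      then show ?thesis using that[of c] by (simp add: abs_mult)
    qed
    have "\<bar>f c\<bar> \<le> \<epsilon> * \<bar>c\<bar>"
      using lt[of c] c that by (simp add: abs_divide field_simps)
    also have "\<dots> \<le> \<epsilon> * \<bar>t\<bar>"
      using c assms by simp
    finally have "\<bar>t\<bar> * \<bar>f c\<bar> \<le> \<bar>t\<bar> * (\<epsilon> * \<bar>t\<bar>)"
      by (intro mult_left_mono) auto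
    then show ?thesis
      using c by (simp add: power2_eq_square algebra_simps flip: abs_mult)
  qed
  then show thesis
    using that[OF \<delta>] by fastforce
qed

text \<open>The quotient of \<open>F t\<close> by \<open>t\<^sup>2\<close> tends to 0 at the origin
  and does not decrease when moving away from it on either side.\<close>

lemma F_nonneg: "0 \<le> F t"
proof (cases "t = 0")
  case False
  have "- \<epsilon> \<le> F t / t\<^sup>2" if eps: "\<epsilon> > 0" for \<epsilon>
  proof -
    obtain \<delta> where \<delta>: "\<delta> > 0" "\<And>t. \<bar>t\<bar> < \<delta> \<Longrightarrow> \<bar>F t\<bar> \<le> \<epsilon> * t\<^sup>2"
      using F_small[OF eps] by blast
    \<comment> \<open>Small enough for the estimate near 0, and no further from 0 than
      \<open>t\<close>, so that monotonicity compares the two points.\<close>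
    define s where "s = min (\<delta> / 2) \<bar>t\<bar>"
    have s: "0 < s" "s < \<delta>" "s \<le> \<bar>t\<bar>" using \<delta> False by (auto simp: s_def)
    have "- \<epsilon> \<le> F r / r\<^sup>2" if "\<bar>r\<bar> = s" for r
    proof -
      have "r \<noteq> 0" using that s by auto
      then show ?thesis
        using \<delta>(2)[of r] that s by (simp add: pos_le_divide_eq)
    qed
    moreover have "\<exists>r. \<bar>r\<bar> = s \<and> F r / r\<^sup>2 \<le> F t / t\<^sup>2"
    proof (cases "t > 0")
      case True
      then show ?thesis using s mono by (intro exI[of _ s]) (auto simp: monotone_on_def)
    next
      case False
      then show ?thesis
        using s monotone_onD[OF antimono, of t "- s"] \<open>t \<noteq> 0\<close> by (intro exI[of _ "- s"]) simp
    qed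
    ultimately show ?thesis by force
  qed
  then have "0 \<le> F t / t\<^sup>2"
    by (metis add.inverse_inverse neg_less_0_iff_less not_le order.refl dense leD)
  then show ?thesis using False by (simp add: zero_le_divide_iff)
qed simp

text \<open>Monotonicity of the quotient says that \<open>F\<close> grows at least quadratically;
  hence scaling up a function of negative energy makes the energy at least quadratically more
  negative.\<close>

lemma F_scale:
  assumes "1 \<le> \<theta>" "0 \<le> t"
  shows "\<theta>\<^sup>2 * F t \<le> F (\<theta> * t)"
proof (cases "t = 0")
  case False
  then have "t > 0" "t \<le> \<theta> * t" "0 < \<theta>" using assms by auto
  then have "F t / t\<^sup>2 \<le> F (\<theta> * t) / (\<theta> * t)\<^sup>2"
    using monotone_onD[OF mono, of t "\<theta> * t"] by simp
  then show ?thesis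
    using \<open>t > 0\<close> \<open>0 < \<theta>\<close> by (simp add: field_simps power_mult_distrib)
qed simp

text \<open>The hypothesis \<open>le_abs\<close> reduces negative arguments to positive ones, where
  the quotient is largest at the right end \<open>a\<close>.\<close>

lemma F_le_square:
  assumes "\<bar>t\<bar> \<le> a" "0 < a"
  shows "F t \<le> F a / a\<^sup>2 * t\<^sup>2"
proof (cases "t = 0")
  case False
  then have "F \<bar>t\<bar> / \<bar>t\<bar>\<^sup>2 \<le> F a / a\<^sup>2"
    using assms monotone_onD[OF mono, of "\<bar>t\<bar>" a] by simp
  then have "F \<bar>t\<bar> \<le> F a / a\<^sup>2 * t\<^sup>2"
    using False by (simp add: pos_divide_le_eq)
  then show ?thesis using le_abs[of t] by linarith
qed simp

lemma F_summable:
  fixes u :: "'a \<Rightarrow> real"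
  assumes "(\<lambda>x. (u x)\<^sup>2) summable_on UNIV"
  shows "(\<lambda>x. F (u x)) summable_on UNIV"
proof (rule summable_on_comparison_test)
  \<comment> \<open>The \<open>\<ell>\<^sup>2\<close> norm bounds \<open>u\<close> pointwise; adding
    1 keeps \<open>M\<close> positive even for \<open>u = 0\<close>.\<close>
  define M where "M = sqrt (\<Sum>\<^sub>\<infinity>x. (u x)\<^sup>2) + 1"
  have M: "M > 0" by (simp add: M_def infsum_nonneg add_nonneg_pos)
  show "(\<lambda>x. F M / M\<^sup>2 * (u x)\<^sup>2) summable_on UNIV"
    using assms by (rule summable_on_cmult_right)
  fix x
  have "\<bar>u x\<bar> \<le> sqrt (\<Sum>\<^sub>\<infinity>x. (u x)\<^sup>2)"
    using le_infsum_nonneg[OF assms, of x] by (intro real_le_rsqrt) simp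
  then have "\<bar>u x\<bar> \<le> M" by (simp add: M_def)
  then show "F (u x) \<le> F M / M\<^sup>2 * (u x)\<^sup>2"
    using M by (rule F_le_square)
qed (rule F_nonneg)

text \<open>On the sphere every value is at most \<open>sqrt m\<close> in modulus, so the quadratic
  bound on \<open>F\<close> sums to \<open>F (sqrt m)\<close>. This makes the real infimum
  meaningful later.\<close>

lemma energy_ge:
  assumes "u \<in> mass_sphere m" "m > 0"
  shows "- F (sqrt m) \<le> energy f u"
proof -
  have sq: "(\<lambda>x. (u x)\<^sup>2) summable_on UNIV" and m: "(\<Sum>\<^sub>\<infinity>x. (u x)\<^sup>2) = m"
    using assms(1) by (auto simp: mass_sphere_iff)
  have "(\<Sum>\<^sub>\<infinity>x. F (u x)) \<le> (\<Sum>\<^sub>\<infinity>x. F (sqrt m) / (sqrt m)\<^sup>2 * (u x)\<^sup>2)"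
  proof (rule infsum_mono)
    fix x
    have "\<bar>u x\<bar> \<le> sqrt m"
      using le_infsum_nonneg[OF sq, of x] m by (intro real_le_rsqrt) simp
    then show "F (u x) \<le> F (sqrt m) / (sqrt m)\<^sup>2 * (u x)\<^sup>2"
      using assms(2) by (intro F_le_square) auto
  qed (intro F_summable summable_on_cmult_right sq)+
  also have "\<dots> = F (sqrt m)"
    unfolding infsum_cmult_right' m using assms(2) by simp
  moreover have "0 \<le> (\<Sum>\<^sub>\<infinity>x. (lattice_grad u x)\<^sup>2)"
    by (simp add: infsum_nonneg)
  ultimately show ?thesis
    by (simp add: energy_def)
qed

text \<open>The gradient term scales exactly by \<open>\<theta>\<^sup>2\<close>, and the subtracted
  term by at least that factor.\<close>

lemma energy_scale:
  fixes u :: "int ^ 'n \<Rightarrow> real"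
  assumes "(\<lambda>x. (u x)\<^sup>2) summable_on UNIV" "\<And>x. 0 \<le> u x" "1 \<le> \<theta>"
  shows "energy f (\<lambda>x. \<theta> * u x) \<le> \<theta>\<^sup>2 * energy f u"
proof -
  have sq: "(\<lambda>x. (\<theta> * u x)\<^sup>2) summable_on UNIV"
    unfolding power_mult_distrib using assms(1) by (rule summable_on_cmult_right)
  have "(lattice_grad (\<lambda>x. \<theta> * u x) x)\<^sup>2 = \<theta>\<^sup>2 * (lattice_grad u x)\<^sup>2" for x
    unfolding lattice_grad_square
    by (simp add: power_mult_distrib sum_distrib_left flip: right_diff_distrib)
  then have "(\<Sum>\<^sub>\<infinity>x. (lattice_grad (\<lambda>x. \<theta> * u x) x)\<^sup>2) = \<theta>\<^sup>2 * (\<Sum>\<^sub>\<infinity>x. (lattice_grad u x)\<^sup>2)"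
    by (simp add: infsum_cmult_right')
  moreover have "\<theta>\<^sup>2 * (\<Sum>\<^sub>\<infinity>x. F (u x)) \<le> (\<Sum>\<^sub>\<infinity>x. F (\<theta> * u x))"
    unfolding infsum_cmult_right'[symmetric]
    by (intro infsum_mono summable_on_cmult_right F_summable sq assms F_scale)
  ultimately show ?thesis
    by (simp add: energy_def algebra_simps)
qed

text \<open>The adjacency form of a nonnegative function is nonnegative, so the gradient term is at
  most degree times mass.\<close>

lemma energy_point_mass:
  fixes a :: real
  defines "u \<equiv> (\<lambda>x :: int ^ 'n. if x = 0 then a else 0)"
  assumes "0 \<le> a"
  shows "u \<in> mass_sphere (a\<^sup>2)" "energy f u \<le> CARD('n) * a\<^sup>2 - F a"
proof -
  have S: "((\<lambda>x. (u x)\<^sup>2) has_sum a\<^sup>2) UNIV"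
    by (rule has_sum_finite_neutralI[of "{0}"]) (auto simp: u_def)
  have P: "((\<lambda>x. F (u x)) has_sum F a) UNIV"
    by (rule has_sum_finite_neutralI[of "{0}"]) (auto simp: u_def)
  have sq: "(\<lambda>x. (u x)\<^sup>2) summable_on UNIV"
    using S by (rule has_sum_imp_summable)
  then show "u \<in> mass_sphere (a\<^sup>2)"
    using infsumI[OF S] by (simp add: mass_sphere_iff)
  have "0 \<le> (\<Sum>\<^sub>\<infinity>x. u x * neighbour_sum u x)"
    using assms(2) by (intro infsum_nonneg mult_nonneg_nonneg)
      (auto simp: u_def neighbour_sum_def intro!: sum_nonneg)
  then have "(\<Sum>\<^sub>\<infinity>x. (lattice_grad u x)\<^sup>2) \<le> lattice_degree TYPE('n) * a\<^sup>2"
    unfolding infsum_lattice_grad_square[OF sq] infsumI[OF S] by simp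
  also have "\<dots> \<le> real (2 * CARD('n)) * a\<^sup>2"
    using lattice_degree_le[where 'n = 'n] by (intro mult_right_mono) (simp_all only: of_nat_le_iff zero_le_power2)
  finally show "energy f u \<le> CARD('n) * a\<^sup>2 - F a"
    by (simp add: energy_def infsumI[OF P])
qed

text \<open>The error depends on \<open>u\<close> only through its mass, so one finite set
  \<open>K\<close> serves a whole sequence on the sphere.\<close>

lemma infsum_F_tail:
  fixes u :: "'a \<Rightarrow> real"
  assumes sq: "(\<lambda>x. (u x)\<^sup>2) summable_on UNIV" and "finite K"
    and le: "\<And>x. x \<notin> K \<Longrightarrow> F (u x) \<le> \<epsilon> * (u x)\<^sup>2" and "0 \<le> \<epsilon>"
  shows "\<bar>(\<Sum>\<^sub>\<infinity>x. F (u x)) - (\<Sum>x\<in>K. F (u x))\<bar> \<le> \<epsilon> * (\<Sum>\<^sub>\<infinity>x. (u x)\<^sup>2)"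
proof -
  have "((\<lambda>x. (if x \<in> K then F (u x) else 0) + \<epsilon> * (u x)\<^sup>2) has_sum
      ((\<Sum>x\<in>K. F (u x)) + \<epsilon> * (\<Sum>\<^sub>\<infinity>x. (u x)\<^sup>2))) UNIV"
    by (intro has_sum_add has_sum_cmult_right has_sum_infsum sq has_sum_finite_neutralI[OF \<open>finite K\<close>]) auto
  then have "(\<Sum>\<^sub>\<infinity>x. F (u x)) \<le> (\<Sum>x\<in>K. F (u x)) + \<epsilon> * (\<Sum>\<^sub>\<infinity>x. (u x)\<^sup>2)"
    by (rule has_sum_mono[OF has_sum_infsum[OF F_summable[OF sq]]]) (use le \<open>0 \<le> \<epsilon>\<close> in auto)
  moreover have "(\<Sum>x\<in>K. F (u x)) \<le> (\<Sum>\<^sub>\<infinity>x. F (u x))"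
    by (rule finite_sum_le_infsum[OF F_summable[OF sq] \<open>finite K\<close>]) (auto simp: F_nonneg)
  ultimately show ?thesis by linarith
qed

end

section \<open>Positivity of minimisers\<close>

lemma has_sum_two_points:
  fixes g :: "'a \<Rightarrow> real"
  assumes "p \<noteq> q" "\<And>x. x \<noteq> p \<Longrightarrow> x \<noteq> q \<Longrightarrow> g x = 0"
  shows "(g has_sum (g p + g q)) UNIV"
  by (rule has_sum_finite_neutralI[of "{p, q}"]) (use assms in auto)

lemma infsum_change_two_points:
  fixes g h :: "'a \<Rightarrow> real"
  assumes "p \<noteq> q" "\<And>x. x \<noteq> p \<Longrightarrow> x \<noteq> q \<Longrightarrow> g x = h x" "h summable_on UNIV"
  shows "g summable_on UNIV" "infsum g UNIV = infsum h UNIV + (g p - h p) + (g q - h q)"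
proof -
  have "((\<lambda>x. g x - h x) has_sum ((g p - h p) + (g q - h q))) UNIV"
    using assms(1,2) by (intro has_sum_two_points) auto
  from has_sum_add[OF has_sum_infsum[OF assms(3)] this]
  have "(g has_sum (infsum h UNIV + ((g p - h p) + (g q - h q)))) UNIV" by simp
  then show "g summable_on UNIV" "infsum g UNIV = infsum h UNIV + (g p - h p) + (g q - h q)"
    by (auto dest: has_sum_imp_summable infsumI)
qed

text \<open>Expansion of the adjacency form under a perturbation \<open>h\<close>; the two mixed
  terms coincide by symmetry of the operator.\<close>

lemma infsum_mult_neighbour_sum_add:
  fixes w h :: "int ^ 'n \<Rightarrow> real"
  assumes w: "(\<lambda>x. (w x)\<^sup>2) summable_on UNIV" and h: "(\<lambda>x. (h x)\<^sup>2) summable_on UNIV"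
  shows "(\<Sum>\<^sub>\<infinity>x. (w x + h x) * neighbour_sum (\<lambda>x. w x + h x) x)
    = (\<Sum>\<^sub>\<infinity>x. w x * neighbour_sum w x) + 2 * (\<Sum>\<^sub>\<infinity>x. h x * neighbour_sum w x)
      + (\<Sum>\<^sub>\<infinity>x. h x * neighbour_sum h x)"
proof -
  have "((\<lambda>x. w x * neighbour_sum w x + w x * neighbour_sum h x + h x * neighbour_sum w x
      + h x * neighbour_sum h x) has_sum
    ((\<Sum>\<^sub>\<infinity>x. w x * neighbour_sum w x) + (\<Sum>\<^sub>\<infinity>x. w x * neighbour_sum h x)
      + (\<Sum>\<^sub>\<infinity>x. h x * neighbour_sum w x) + (\<Sum>\<^sub>\<infinity>x. h x * neighbour_sum h x))) UNIV"
    by (intro has_sum_add has_sum_infsum neighbour_sum_mult_summable w h)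
  then have "((\<lambda>x. (w x + h x) * neighbour_sum (\<lambda>x. w x + h x) x) has_sum
    ((\<Sum>\<^sub>\<infinity>x. w x * neighbour_sum w x) + (\<Sum>\<^sub>\<infinity>x. w x * neighbour_sum h x)
      + (\<Sum>\<^sub>\<infinity>x. h x * neighbour_sum w x) + (\<Sum>\<^sub>\<infinity>x. h x * neighbour_sum h x))) UNIV"
    by (simp add: neighbour_sum_def sum.distrib algebra_simps)
  from infsumI[OF this] show ?thesis
    using neighbour_sum_symmetric[OF w h] by simp
qed

context nls_nonlinearity
begin

text \<open>If \<open>w\<close> vanishes at \<open>p\<close> but equals \<open>a > 0\<close> at a neighbour \<open>q\<close>, replacing these values by
  \<open>s\<close> and \<open>sqrt (a\<^sup>2 - s\<^sup>2)\<close> preserves the mass. The edge \<open>pq\<close> lowers the energy by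
  \<open>s * a\<close>, while all other changes are of order \<open>s\<^sup>2\<close>.\<close>

lemma minimiser_pos:
  fixes w :: "int ^ 'n \<Rightarrow> real"
  assumes w: "w \<in> mass_sphere m" and "m > 0" and nonneg: "\<And>x. 0 \<le> w x"
    and minimal: "\<And>u :: int ^ 'n \<Rightarrow> real. u \<in> mass_sphere m \<Longrightarrow> energy f w \<le> energy f u"
  shows "0 < w z"
proof (rule ccontr)
  assume "\<not> 0 < w z"
  then have z: "w z = 0" using nonneg[of z] by linarith
  have sq: "(\<lambda>x. (w x)\<^sup>2) summable_on UNIV" and m: "(\<Sum>\<^sub>\<infinity>x. (w x)\<^sup>2) = m"
    using w by (auto simp: mass_sphere_iff)
  \<comment> \<open>Otherwise the zero set would be closed under adjacency, and by connectedness
    \<open>w\<close> would vanish everywhere, against positive mass.\<close>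
  have "\<exists>p q. w p = 0 \<and> lattice_adj q p \<and> w q \<noteq> 0"
  proof (rule ccontr)
    assume "\<nexists>p q. w p = 0 \<and> lattice_adj q p \<and> w q \<noteq> 0"
    then have "w x = 0" for x
      using lattice_connected[of "\<lambda>x. w x = 0" z x] z by blast
    then show False using m \<open>m > 0\<close> by simp
  qed
  then obtain p q where p: "w p = 0" and adj: "lattice_adj q p" and q: "w q \<noteq> 0"
    by blast
  have pq: "p \<noteq> q" using p q by auto
  define a where "a = w q"
  have a: "a > 0" using nonneg[of q] q by (simp add: a_def)
  obtain L where L: "\<And>t. t \<in> {0..a} \<Longrightarrow> \<bar>f t\<bar> \<le> L"
  proof -
    have "bounded (f ` {0..a})"
      by (intro compact_imp_bounded compact_continuous_image continuous_on_subset[OF continuous]) auto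
    then obtain L where "\<forall>t\<in>{0..a}. \<bar>f t\<bar> \<le> L" by (auto simp: bounded_iff)
    then show thesis using that[of L] by blast
  qed
  have "0 \<le> L" using L[of 0] a by force
  define A where "A = neighbour_sum w q"
  have "0 \<le> A" using nonneg by (simp add: A_def neighbour_sum_def sum_nonneg)
  \<comment> \<open>The cost per unit decrease at \<open>q\<close>: \<open>A\<close> for the
    coupling with the neighbours of \<open>q\<close>, 1 for the product \<open>s * c\<close> (as
    \<open>s \<le> 1\<close>), and \<open>L\<close> for the change of \<open>F\<close>.\<close>
  define B where "B = A + 1 + L"
  have B: "B > 0" using \<open>0 \<le> A\<close> \<open>0 \<le> L\<close> by (simp add: B_def)
  \<comment> \<open>The three bounds serve the estimate by \<open>B\<close>, the positivity of
    \<open>b\<close>, and the final absorption of the cost into half of the gain.\<close>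
  define s where "s = min 1 (min (a / 2) (a\<^sup>2 / (2 * B)))"
  have s: "0 < s" "s \<le> 1" "s < a" "s * B \<le> a\<^sup>2 / 2"
  proof -
    show "0 < s" "s \<le> 1" "s < a" using a B by (auto simp: s_def min_less_iff_disj)
    have "s \<le> a\<^sup>2 / (2 * B)" by (simp add: s_def)
    then show "s * B \<le> a\<^sup>2 / 2" using B by (simp add: field_simps)
  qed
  define b where "b = sqrt (a\<^sup>2 - s\<^sup>2)"
  have s2: "s\<^sup>2 < a\<^sup>2" using s by (intro power_strict_mono) auto
  have b2: "b\<^sup>2 = a\<^sup>2 - s\<^sup>2" using s2 by (simp add: b_def)
  have b: "0 < b" "b < a"
  proof -
    show "0 < b" using s2 by (simp add: b_def)
    show "b < a" using b2 s a by (intro power2_less_imp_less[of b a]) auto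
  qed
  define c where "c = a - b"
  have c: "0 < c" using b by (simp add: c_def)
  \<comment> \<open>The loss \<open>c\<close> at \<open>q\<close> is of second order in
    \<open>s\<close>, since \<open>c * (a + b)\<close> equals \<open>s\<^sup>2\<close>.\<close>
  have ca: "c * a \<le> s\<^sup>2"
  proof -
    have "c * (a + b) = s\<^sup>2" using b2 by (simp add: c_def power2_eq_square algebra_simps)
    moreover have "0 \<le> c * b" using b c by simp
    ultimately show ?thesis by (simp add: distrib_left)
  qed
  define h where "h x = (if x = p then s else if x = q then - c else 0)" for x
  define u where "u x = w x + h x" for x
  have u: "u p = s" "u q = b" "\<And>x. x \<noteq> p \<Longrightarrow> x \<noteq> q \<Longrightarrow> u x = w x"
    using p pq by (auto simp: u_def h_def c_def a_def)
  have sqh: "(\<lambda>x. (h x)\<^sup>2) summable_on UNIV"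
    by (intro has_sum_imp_summable[OF has_sum_two_points[OF pq]]) (simp add: h_def)
  have sqdiff: "(\<lambda>x. (u x)\<^sup>2) summable_on UNIV" "(\<Sum>\<^sub>\<infinity>x. (u x)\<^sup>2) = m"
    using infsum_change_two_points[OF pq _ sq, of "\<lambda>x. (u x)\<^sup>2"] u p b2 m by (auto simp: a_def)
  then have u_mass: "u \<in> mass_sphere m" by (simp add: mass_sphere_iff)
  have Fdiff: "(\<Sum>\<^sub>\<infinity>x. F (u x)) = (\<Sum>\<^sub>\<infinity>x. F (w x)) + F s + (F b - F a)"
    using infsum_change_two_points(2)[OF pq _ F_summable[OF sq], of "\<lambda>x. F (u x)"] u p by (simp add: a_def)
  have "(\<Sum>\<^sub>\<infinity>x. h x * neighbour_sum w x) = s * neighbour_sum w p - c * A"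
    using infsumI[OF has_sum_two_points[OF pq, of "\<lambda>x. h x * neighbour_sum w x"]] pq
    by (simp add: h_def A_def)
  moreover have "a \<le> neighbour_sum w p"
    unfolding a_def neighbour_sum_def
    by (rule member_le_sum) (use adj nonneg finite_lattice_neighbours in auto)
  then have "s * a \<le> s * neighbour_sum w p" using s by simp
  ultimately have hw: "s * a - c * A \<le> (\<Sum>\<^sub>\<infinity>x. h x * neighbour_sum w x)"
    by simp
  have "(\<Sum>\<^sub>\<infinity>x. h x * neighbour_sum h x) = s * neighbour_sum h p - c * neighbour_sum h q"
    using infsumI[OF has_sum_two_points[OF pq, of "\<lambda>x. h x * neighbour_sum h x"]] pq
    by (simp add: h_def)
  \<comment> \<open>The perturbation lives on \<open>p\<close> and \<open>q\<close>, so only the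
    edge between them enters its adjacency form; the two one-sided bounds give a lower bound of
    \<open>- 2 * (s * c)\<close>.\<close>
  moreover have "- c \<le> neighbour_sum h p"
  proof -
    have "(\<Sum>y | lattice_adj y p. if y = q then - c else 0) \<le> neighbour_sum h p"
      unfolding neighbour_sum_def using s pq by (intro sum_mono) (auto simp: h_def)
    then show ?thesis using adj finite_lattice_neighbours[of p] by simp
  qed
  then have "s * (- c) \<le> s * neighbour_sum h p" using s by (intro mult_left_mono) auto
  moreover have "neighbour_sum h q \<le> s"
  proof -
    have "neighbour_sum h q \<le> (\<Sum>y | lattice_adj y q. if y = p then s else 0)"
      unfolding neighbour_sum_def using c pq by (intro sum_mono) (auto simp: h_def)
    then show ?thesis using adj finite_lattice_neighbours[of q] by (simp add: lattice_adj_commute[of p])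
  qed
  then have "c * neighbour_sum h q \<le> c * s" using c by (intro mult_left_mono) auto
  ultimately have hh: "- 2 * (s * c) \<le> (\<Sum>\<^sub>\<infinity>x. h x * neighbour_sum h x)"
    by (simp add: mult.commute)
  have "F a - F b \<le> c * L"
  proof -
    obtain \<xi> where "b < \<xi>" "\<xi> < a" "F a - F b = (a - b) * f \<xi>"
      using b(2) by (rule F_mvt)
    moreover have "f \<xi> \<le> L" using L[of \<xi>] calculation b by force
    ultimately show ?thesis using c by (simp add: c_def mult_left_mono)
  qed
  \<comment> \<open>Equal masses cancel the degree terms, leaving the change of the adjacency form
    and of the sums of \<open>F\<close>.\<close>
  moreover have "energy f u - energy f w
      = - (\<Sum>\<^sub>\<infinity>x. h x * neighbour_sum w x) - 1/2 * (\<Sum>\<^sub>\<infinity>x. h x * neighbour_sum h x)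
        - F s + (F a - F b)"
    using infsum_mult_neighbour_sum_add[OF sq sqh] Fdiff
    unfolding energy_def infsum_lattice_grad_square[OF sq] infsum_lattice_grad_square[OF sqdiff(1)]
      m sqdiff(2) u_def[symmetric]
    by (simp add: algebra_simps)
  ultimately have "energy f u - energy f w \<le> - (s * a) + (c * A + s * c + c * L)"
    using hw hh F_nonneg[of s] by linarith
  also have "c * A + s * c + c * L \<le> c * B"
    using s c by (simp add: B_def algebra_simps)
  \<comment> \<open>Multiplying by \<open>a\<close> brings in \<open>c * a\<close>, which is at most
    \<open>s\<^sup>2\<close>; the cost is then at most half of the gain
    \<open>s * a\<^sup>2\<close>.\<close>
  finally have "(energy f u - energy f w) * a \<le> (- (s * a) + c * B) * a"
    using a by (intro mult_right_mono) auto
  also have "\<dots> = - (s * a\<^sup>2) + (c * a) * B"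
    by (simp add: algebra_simps power2_eq_square)
  also have "(c * a) * B \<le> s\<^sup>2 * B"
    using ca B by (intro mult_right_mono) auto
  also have "s\<^sup>2 * B = s * (s * B)" by (simp add: power2_eq_square)
  also have "s * (s * B) \<le> s * (a\<^sup>2 / 2)"
    using s by (intro mult_left_mono) auto
  finally have "(energy f u - energy f w) * a \<le> - (s * a\<^sup>2) + s * (a\<^sup>2 / 2)" by simp
  also have "\<dots> < 0" using s a by simp
  finally have "energy f u < energy f w" using a by (simp add: mult_less_0_iff)
  then show False using minimal[OF u_mass] by simp
qed

end

section \<open>Existence of minimisers\<close>

lemma finite_superlevel:
  fixes g :: "'a \<Rightarrow> real"
  assumes "g summable_on UNIV" "\<And>x. 0 \<le> g x" "t > 0"
  shows "finite {x. t < g x}"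
proof (rule ccontr)
  assume inf: "infinite {x. t < g x}"
  obtain n where n: "infsum g UNIV < real n * t"
    using reals_Archimedean3[OF \<open>t > 0\<close>] by blast
  obtain B where B: "finite B" "card B = n" "B \<subseteq> {x. t < g x}"
    using infinite_arbitrarily_large[OF inf] by blast
  have "real n * t = (\<Sum>x\<in>B. t)" using B by simp
  also have "\<dots> \<le> sum g B" using B by (intro sum_mono) auto
  also have "\<dots> \<le> infsum g UNIV"
    by (rule finite_sum_le_infsum) (use assms B in auto)
  finally show False using n by simp
qed

lemma square_summable_finite_superlevel:
  fixes u :: "'a \<Rightarrow> real"
  assumes "(\<lambda>x. (u x)\<^sup>2) summable_on UNIV" "t > 0"
  shows "finite {x. t < u x}"
  by (rule finite_subset[OF _ finite_superlevel[OF assms(1), of "t\<^sup>2"]])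
     (use assms(2) in \<open>auto intro!: power_strict_mono\<close>)

lemma admissible_square_summable:
  assumes "(\<lambda>x. (u x)\<^sup>2) summable_on UNIV" "\<And>x. 0 \<le> u x"
  shows "u \<in> admissible"
  using assms square_summable_finite_superlevel by (auto simp: admissible_def)

text \<open>One factor of the cube is bounded by the \<open>\<ell>\<^sup>2\<close> norm. The
  exponent 3 is a convenient choice above 2 for the compact embedding.\<close>

lemma lp_space_3_if_square_summable:
  fixes u :: "'a \<Rightarrow> real"
  assumes "(\<lambda>x. (u x)\<^sup>2) summable_on UNIV"
  shows "u \<in> lp_space 3"
proof -
  let ?M = "sqrt (\<Sum>\<^sub>\<infinity>x. (u x)\<^sup>2)"
  have "(\<lambda>x. \<bar>u x\<bar> powr 3) summable_on UNIV"
  proof (rule summable_on_comparison_test)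
    show "(\<lambda>x. ?M * (u x)\<^sup>2) summable_on UNIV"
      using assms by (rule summable_on_cmult_right)
    fix x
    have "\<bar>u x\<bar> \<le> ?M"
      using le_infsum_nonneg[OF assms, of x] by (intro real_le_rsqrt) simp
    then have "\<bar>u x\<bar> * (u x)\<^sup>2 \<le> ?M * (u x)\<^sup>2" by (intro mult_right_mono) auto
    then show "\<bar>u x\<bar> powr 3 \<le> ?M * (u x)\<^sup>2"
      by (simp add: power3_eq_cube power2_eq_square mult.assoc)
  qed auto
  then show ?thesis by (simp add: lp_space_def)
qed

lemma lp_space_3_diff:
  fixes u v :: "'a \<Rightarrow> real"
  assumes "u \<in> lp_space 3" "v \<in> lp_space 3"
  shows "(\<lambda>x. u x - v x) \<in> lp_space 3"
proof -
  have "(\<lambda>x. \<bar>u x - v x\<bar> powr 3) summable_on UNIV"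
  proof (rule summable_on_comparison_test)
    show "(\<lambda>x. 8 * (\<bar>u x\<bar> powr 3 + \<bar>v x\<bar> powr 3)) summable_on UNIV"
      using assms by (intro summable_on_cmult_right summable_on_add) (auto simp: lp_space_def)
    fix x
    have "\<bar>u x - v x\<bar> ^ 3 \<le> (2 * max \<bar>u x\<bar> \<bar>v x\<bar>) ^ 3"
      by (intro power_mono) auto
    also have "\<dots> = 8 * max \<bar>u x\<bar> \<bar>v x\<bar> ^ 3"
      by (simp add: power_mult_distrib)
    also have "\<dots> \<le> 8 * (\<bar>u x\<bar> ^ 3 + \<bar>v x\<bar> ^ 3)"
      by (simp add: max_def)
    finally show "\<bar>u x - v x\<bar> powr 3 \<le> 8 * (\<bar>u x\<bar> powr 3 + \<bar>v x\<bar> powr 3)"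
      by simp
  qed auto
  then show ?thesis by (simp add: lp_space_def)
qed

text \<open>Turns convergence in \<open>\<ell>\<^sup>3\<close> into uniform convergence.\<close>

lemma abs_le_lp_norm:
  assumes "u \<in> lp_space p" "p > 0"
  shows "\<bar>u x\<bar> \<le> lp_norm p u"
proof -
  have "\<bar>u x\<bar> = (\<bar>u x\<bar> powr p) powr (1 / p)"
    using assms(2) by (simp add: powr_powr)
  also have "\<dots> \<le> lp_norm p u"
    unfolding lp_norm_def using assms
    by (intro powr_mono2 le_infsum_nonneg) (auto simp: lp_space_def)
  finally show ?thesis .
qed

section \<open>Symmetrisation, compactness and the minimiser\<close>

locale schwarz_nls = nls_nonlinearity f + schwarz_rearrangement R
  for f :: "real \<Rightarrow> real" and R :: "(int ^ 'n \<Rightarrow> real) \<Rightarrow> int ^ 'n \<Rightarrow> real"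
begin

text \<open>The function is the rearrangement of the modulus. The modulus raises neither the
  gradient term nor, by \<open>le_abs\<close>, the energy; the rearrangement keeps the sums of
  squares and of \<open>F\<close> by equimeasurability and lowers the gradient term.\<close>

lemma symmetrise:
  fixes u :: "int ^ 'n \<Rightarrow> real"
  assumes "u \<in> mass_sphere m"
  obtains v where "v \<in> mass_sphere m" "schwarz_symmetric R v" "energy f v \<le> energy f u"
proof -
  define a where "a x = \<bar>u x\<bar>" for x
  have sq: "(\<lambda>x. (u x)\<^sup>2) summable_on UNIV" and m: "(\<Sum>\<^sub>\<infinity>x. (u x)\<^sup>2) = m"
    using assms by (auto simp: mass_sphere_iff)
  have sqa: "(\<lambda>x. (a x)\<^sup>2) summable_on UNIV" and ma: "(\<Sum>\<^sub>\<infinity>x. (a x)\<^sup>2) = m"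
    using sq m by (simp_all add: a_def)
  have adm: "a \<in> admissible"
    using sqa by (rule admissible_square_summable) (simp add: a_def)
  then have admR: "R a \<in> admissible" by (rule maps_admissible)
  have sqR: "(\<lambda>x. (R a x)\<^sup>2) summable_on UNIV" "(\<Sum>\<^sub>\<infinity>x. (R a x)\<^sup>2) = m"
    using infsum_ennreal_eq[OF sqa _ _ equimeasurable[of "\<lambda>t. t\<^sup>2", OF _ _ adm]] ma by auto
  have FR: "(\<Sum>\<^sub>\<infinity>x. F (R a x)) = (\<Sum>\<^sub>\<infinity>x. F (a x))"
    using infsum_ennreal_eq(2)[OF F_summable[OF sqa] _ _ equimeasurable[of F, OF _ _ adm]]
    by (auto simp: F_nonneg)
  have "lp_norm 2 (lattice_grad (R a)) \<le> lp_norm 2 (lattice_grad a)"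
    using sqa by (intro polya_szego) (auto simp: lp_space_2_iff a_def)
  from power_mono[OF this lp_norm_nonneg, of 2]
  have "(\<Sum>\<^sub>\<infinity>x. (lattice_grad (R a) x)\<^sup>2) \<le> (\<Sum>\<^sub>\<infinity>x. (lattice_grad a x)\<^sup>2)"
    by (simp only: lp_norm_2_square)
  also have "\<dots> \<le> (\<Sum>\<^sub>\<infinity>x. (lattice_grad u x)\<^sup>2)"
    using infsum_lattice_grad_abs_le[OF sq] by (simp add: a_def[abs_def])
  finally have "(\<Sum>\<^sub>\<infinity>x. (lattice_grad (R a) x)\<^sup>2) \<le> (\<Sum>\<^sub>\<infinity>x. (lattice_grad u x)\<^sup>2)" .
  moreover have "(\<Sum>\<^sub>\<infinity>x. F (u x)) \<le> (\<Sum>\<^sub>\<infinity>x. F (a x))"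
    unfolding a_def by (intro infsum_mono F_summable sq le_abs) (use sqa in \<open>simp add: a_def\<close>)
  ultimately have "energy f (R a) \<le> energy f u"
    using FR by (simp add: energy_def)
  moreover have "R a \<in> mass_sphere m"
    using sqR by (simp add: mass_sphere_iff)
  moreover have "schwarz_symmetric R (R a)"
    using admR idempotent[OF adm] by (simp add: schwarz_symmetric_def)
  ultimately show thesis by (intro that)
qed

text \<open>Mass may be lost in the limit, but the sums of \<open>F\<close> converge: on a finite
  set by continuity, and elsewhere because both functions are uniformly small and \<open>F\<close>
  is negligible against the square.\<close>

lemma symmetric_limit:
  fixes v :: "nat \<Rightarrow> int ^ 'n \<Rightarrow> real"
  assumes mass: "\<And>k. v k \<in> mass_sphere m" and sym: "\<And>k. schwarz_symmetric R (v k)"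
  obtains r w where "strict_mono r" "schwarz_symmetric R w"
    "(\<lambda>x. (w x)\<^sup>2) summable_on UNIV" "(\<Sum>\<^sub>\<infinity>x. (w x)\<^sup>2) \<le> m"
    "\<And>x. (\<lambda>k. v (r k) x) \<longlonglongrightarrow> w x"
    "(\<lambda>k. \<Sum>\<^sub>\<infinity>x. F (v (r k) x)) \<longlonglongrightarrow> (\<Sum>\<^sub>\<infinity>x. F (w x))"
proof -
  have sq: "(\<lambda>x. (v k x)\<^sup>2) summable_on UNIV" and m: "(\<Sum>\<^sub>\<infinity>x. (v k x)\<^sup>2) = m" for k
    using mass by (auto simp: mass_sphere_iff)
  have "0 \<le> m" unfolding m[of 0, symmetric] by (simp add: infsum_nonneg)
  have "lp_norm 2 (v k) \<le> sqrt m" for k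
    using m by (intro real_le_rsqrt) (simp add: lp_norm_2_square)
  then obtain r w where r: "strict_mono r" and w3: "w \<in> lp_space 3"
    and conv: "(\<lambda>k. lp_norm 3 (\<lambda>x. v (r k) x - w x)) \<longlonglongrightarrow> 0"
    using compact_embedding[of 2 3 v "sqrt m"] sym sq by (auto simp: lp_space_2_iff)
  have unif: "\<bar>v (r k) x - w x\<bar> \<le> lp_norm 3 (\<lambda>x. v (r k) x - w x)" for k x
    using abs_le_lp_norm[OF lp_space_3_diff[OF lp_space_3_if_square_summable[OF sq] w3]] by simp
  have lim: "(\<lambda>k. v (r k) x) \<longlonglongrightarrow> w x" for x
    using Lim_null_comparison[OF always_eventually conv, of "\<lambda>k. v (r k) x - w x"] unif
    by (simp add: LIM_zero_iff)
  have nonneg: "0 \<le> w x" for x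
    by (rule LIMSEQ_le_const[OF lim]) (use sym in \<open>auto simp: schwarz_symmetric_def admissible_def\<close>)
  have sqw: "(\<lambda>x. (w x)\<^sup>2) summable_on UNIV" and mw: "(\<Sum>\<^sub>\<infinity>x. (w x)\<^sup>2) \<le> m"
    using infsum_fatou[of "\<lambda>k x. (v (r k) x)\<^sup>2" "\<lambda>x. (w x)\<^sup>2" "\<lambda>_. m" m]
    by (simp_all add: sq m tendsto_power[OF lim])
  have symw: "schwarz_symmetric R w"
    using sym admissible_square_summable[OF sqw nonneg] lim by (rule pointwise_closed)
  have "(\<lambda>k. \<Sum>\<^sub>\<infinity>x. F (v (r k) x)) \<longlonglongrightarrow> (\<Sum>\<^sub>\<infinity>x. F (w x))"
  proof (rule LIMSEQ_I)
    fix e :: real assume "0 < e"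
    \<comment> \<open>Each of the two tails then costs at most a quarter of \<open>e\<close>, and so
      does the finite part. The added 1 covers \<open>m = 0\<close>.\<close>
    define \<epsilon> where "\<epsilon> = e / (4 * (m + 1))"
    have \<epsilon>: "0 < \<epsilon>" "\<epsilon> * m \<le> e / 4"
      using \<open>0 < e\<close> \<open>0 \<le> m\<close> by (auto simp: \<epsilon>_def field_simps)
    obtain \<delta> where \<delta>: "\<delta> > 0" and small: "\<And>t. \<bar>t\<bar> < \<delta> \<Longrightarrow> \<bar>F t\<bar> \<le> \<epsilon> * t\<^sup>2"
      using F_small[OF \<epsilon>(1)] by blast
    \<comment> \<open>The threshold leaves \<open>\<delta> / 2\<close> for the uniform distance, so
      that \<open>v (r k)\<close> also stays below \<open>\<delta>\<close> off
      \<open>K\<close>.\<close>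
    define K where "K = {x. \<delta> / 2 < w x}"
    have K: "finite K"
      unfolding K_def using \<delta> by (intro square_summable_finite_superlevel sqw) simp
    have tail: "\<bar>(\<Sum>\<^sub>\<infinity>x. F (u x)) - (\<Sum>x\<in>K. F (u x))\<bar> \<le> e / 4"
      if u: "(\<lambda>x. (u x)\<^sup>2) summable_on UNIV" "(\<Sum>\<^sub>\<infinity>x. (u x)\<^sup>2) \<le> m"
        and lt: "\<And>x. x \<notin> K \<Longrightarrow> \<bar>u x\<bar> < \<delta>" for u
    proof -
      have "F (u x) \<le> \<epsilon> * (u x)\<^sup>2" if "x \<notin> K" for x
        using small[OF lt[OF that]] by linarith
      then have "\<bar>(\<Sum>\<^sub>\<infinity>x. F (u x)) - (\<Sum>x\<in>K. F (u x))\<bar> \<le> \<epsilon> * (\<Sum>\<^sub>\<infinity>x. (u x)\<^sup>2)"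
        using \<epsilon> by (intro infsum_F_tail[OF u(1) K]) auto
      also have "\<dots> \<le> \<epsilon> * m" using \<epsilon> u(2) by simp
      finally show ?thesis using \<epsilon> by linarith
    qed
    have wlt: "\<bar>w x\<bar> \<le> \<delta> / 2" if "x \<notin> K" for x
      using that nonneg[of x] by (auto simp: K_def)
    have "(\<lambda>k. \<Sum>x\<in>K. F (v (r k) x)) \<longlonglongrightarrow> (\<Sum>x\<in>K. F (w x))"
      by (intro tendsto_sum isCont_tendsto_compose[OF F_isCont] lim)
    then have "\<forall>\<^sub>F k in sequentially. \<bar>(\<Sum>x\<in>K. F (v (r k) x)) - (\<Sum>x\<in>K. F (w x))\<bar> < e / 4"
      using \<open>0 < e\<close> by (auto dest: tendstoD[of _ _ _ "e / 4"] simp: dist_real_def)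
    moreover have "\<forall>\<^sub>F k in sequentially. lp_norm 3 (\<lambda>x. v (r k) x - w x) < \<delta> / 2"
      using conv \<delta> by (intro order_tendstoD(2)[OF conv]) simp
    ultimately have "\<forall>\<^sub>F k in sequentially. norm ((\<Sum>\<^sub>\<infinity>x. F (v (r k) x)) - (\<Sum>\<^sub>\<infinity>x. F (w x))) < e"
    proof eventually_elim
      case (elim k)
      have "\<bar>v (r k) x\<bar> < \<delta>" if "x \<notin> K" for x
        using wlt[OF that] unif[of k x] elim(2) by linarith
      then have "\<bar>(\<Sum>\<^sub>\<infinity>x. F (v (r k) x)) - (\<Sum>x\<in>K. F (v (r k) x))\<bar> \<le> e / 4"
        by (intro tail) (auto simp: sq m)
      moreover have "\<bar>(\<Sum>\<^sub>\<infinity>x. F (w x)) - (\<Sum>x\<in>K. F (w x))\<bar> \<le> e / 4"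
        using wlt \<delta> by (intro tail sqw mw) force
      ultimately show ?case using elim(1) \<open>0 < e\<close> unfolding real_norm_def by linarith
    qed
    then show "\<exists>no. \<forall>n\<ge>no. norm ((\<Sum>\<^sub>\<infinity>x. F (v (r n) x)) - (\<Sum>\<^sub>\<infinity>x. F (w x))) < e"
      by (simp add: eventually_sequentially)
  qed
  with r symw sqw mw lim show thesis by (rule that)
qed

lemma minimiser_exists:
  fixes u0 :: "int ^ 'n \<Rightarrow> real"
  assumes "m > 0" and u0: "u0 \<in> mass_sphere m" "energy f u0 < 0"
  obtains w where "w \<in> mass_sphere m" "schwarz_symmetric R w"
    "\<And>u :: int ^ 'n \<Rightarrow> real. u \<in> mass_sphere m \<Longrightarrow> energy f w \<le> energy f u"
proof -
  let ?S = "mass_sphere m :: (int ^ 'n \<Rightarrow> real) set"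
  define E where "E = Inf (energy f ` ?S)"
  have bdd: "bdd_below (energy f ` ?S)"
    using energy_ge[OF _ \<open>m > 0\<close>] by (intro bdd_belowI2) auto
  have E_le: "E \<le> energy f u" if "u \<in> ?S" for u
    unfolding E_def using bdd that by (intro cInf_lower) auto
  have "E < 0" using E_le[OF u0(1)] u0(2) by linarith
  have "\<exists>v\<in>?S. schwarz_symmetric R v \<and> energy f v < E + inverse (real (Suc k))" for k
  proof -
    have "Inf (energy f ` ?S) < E + inverse (real (Suc k))"
      by (simp add: E_def)
    then obtain u where "u \<in> ?S" "energy f u < E + inverse (real (Suc k))"
      using u0(1) cInf_lessD[of "energy f ` ?S"] by blast
    moreover obtain v where "v \<in> ?S" "schwarz_symmetric R v" "energy f v \<le> energy f u"
      using \<open>u \<in> ?S\<close> by (rule symmetrise)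
    ultimately show ?thesis by (auto intro: le_less_trans)
  qed
  then obtain v where v: "\<And>k. v k \<in> ?S" "\<And>k. schwarz_symmetric R (v k)"
    "\<And>k. energy f (v k) < E + inverse (real (Suc k))"
    by metis
  obtain r w where r: "strict_mono r" and symw: "schwarz_symmetric R w"
    and sqw: "(\<lambda>x. (w x)\<^sup>2) summable_on UNIV" and mw: "(\<Sum>\<^sub>\<infinity>x. (w x)\<^sup>2) \<le> m"
    and lim: "\<And>x. (\<lambda>k. v (r k) x) \<longlonglongrightarrow> w x"
    and Flim: "(\<lambda>k. \<Sum>\<^sub>\<infinity>x. F (v (r k) x)) \<longlonglongrightarrow> (\<Sum>\<^sub>\<infinity>x. F (w x))"
    using symmetric_limit[of v m, OF v(1,2)] by blast
  have nonneg: "0 \<le> w x" for x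
    using symw by (simp add: schwarz_symmetric_def admissible_def)
  have "(\<Sum>\<^sub>\<infinity>x. (lattice_grad w x)\<^sup>2) \<le> 2 * (E + 0 + (\<Sum>\<^sub>\<infinity>x. F (w x)))"
  \<comment> \<open>Solving the near-minimality bound for the gradient term gives a right-hand side
    that converges, because the sums of \<open>F\<close> do.\<close>
  proof (rule infsum_fatou(2))
    show "(\<lambda>x. (lattice_grad (v (r k)) x)\<^sup>2) summable_on UNIV" for k
      using v(1)[of "r k"] by (intro lattice_grad_summable) (simp add: mass_sphere_iff)
    show "(\<lambda>k. (lattice_grad (v (r k)) x)\<^sup>2) \<longlonglongrightarrow> (lattice_grad w x)\<^sup>2" for x
      unfolding lattice_grad_square by (intro tendsto_intros lim)
    show "(\<Sum>\<^sub>\<infinity>x. (lattice_grad (v (r k)) x)\<^sup>2)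
        \<le> 2 * (E + inverse (real (Suc (r k))) + (\<Sum>\<^sub>\<infinity>x. F (v (r k) x)))" for k
      using v(3)[of "r k"] by (simp add: energy_def)
    have "(\<lambda>k. inverse (real (Suc (r k)))) \<longlonglongrightarrow> 0"
      using LIMSEQ_subseq_LIMSEQ[OF LIMSEQ_inverse_real_of_nat r] by (simp add: o_def)
    then show "(\<lambda>k. 2 * (E + inverse (real (Suc (r k))) + (\<Sum>\<^sub>\<infinity>x. F (v (r k) x))))
        \<longlonglongrightarrow> 2 * (E + 0 + (\<Sum>\<^sub>\<infinity>x. F (w x)))"
      by (intro tendsto_intros Flim)
  qed simp
  then have wE: "energy f w \<le> E" by (simp add: energy_def)
  define m' where "m' = (\<Sum>\<^sub>\<infinity>x. (w x)\<^sup>2)"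
  \<comment> \<open>The zero function has energy 0, which exceeds \<open>E\<close>; so the limit is
    nontrivial and can be rescaled to mass \<open>m\<close>.\<close>
  have "m' > 0"
  proof (rule ccontr)
    assume "\<not> m' > 0"
    then have "(w x)\<^sup>2 \<le> 0" for x
      using le_infsum_nonneg[OF sqw zero_le_power2, of x] unfolding m'_def[symmetric] by linarith
    then have "w = (\<lambda>_. 0)" by auto
    then have "energy f w = 0" by (simp add: energy_def lattice_grad_def)
    then show False using wE \<open>E < 0\<close> by simp
  qed
  define \<theta> where "\<theta> = sqrt (m / m')"
  have \<theta>: "1 \<le> \<theta>" "\<theta>\<^sup>2 = m / m'"
    using mw \<open>m' > 0\<close> \<open>m > 0\<close> by (simp_all add: \<theta>_def flip: m'_def)
  have "(\<lambda>x. \<theta> * w x) \<in> ?S"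
    unfolding mass_sphere_iff power_mult_distrib infsum_cmult_right' \<theta>(2) m'_def[symmetric]
    using \<open>m' > 0\<close> summable_on_cmult_right[OF sqw, of "m / m'"] by simp
  then have "E \<le> energy f (\<lambda>x. \<theta> * w x)" by (rule E_le)
  also have "\<dots> \<le> \<theta>\<^sup>2 * energy f w"
    by (rule energy_scale[OF sqw nonneg \<theta>(1)])
  also have "\<dots> \<le> \<theta>\<^sup>2 * E"
    using wE by (intro mult_left_mono) auto
  finally have "\<theta>\<^sup>2 \<le> 1"
    using \<open>E < 0\<close> by (simp add: mult_le_cancel_right2)
  then have "m' = m"
    using \<theta>(2) \<open>m' > 0\<close> mw by (simp add: field_simps m'_def)
  then have "w \<in> ?S" using sqw by (simp add: mass_sphere_iff m'_def)
  then show thesis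
    using symw wE E_le by (intro that[of w]) (auto intro: order_trans)
qed

end

section \<open>The threshold mass\<close>

theorem corollary1p2:
  fixes f :: "real \<Rightarrow> real"
    and R :: "(int ^ 'n \<Rightarrow> real) \<Rightarrow> (int ^ 'n \<Rightarrow> real)"
    and \<zeta> :: real
  assumes "CARD('n) \<ge> 2"
    and "schwarz_rearrangement R"
    and "continuous_on UNIV f"
    and "((\<lambda>t. f t / t) \<longlongrightarrow> 0) (at 0)"
    and "antimono_on {..<0} (\<lambda>t. primitive f t / t\<^sup>2)"
    and "mono_on {0<..} (\<lambda>t. primitive f t / t\<^sup>2)"
    and "\<And>t. primitive f t \<le> primitive f \<bar>t\<bar>"
    and "\<zeta> > 0"
    and "primitive f \<zeta> - 2 * real CARD('n) * \<zeta>\<^sup>2 > 0"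
  shows "\<exists>m0. 0 \<le> m0 \<and> m0 < \<zeta>\<^sup>2 \<and>
    (\<forall>m>m0. \<exists>u \<in> mass_sphere m.
      ereal (energy f u) = ground_energy TYPE('n) f m \<and>
      (\<forall>x. u x > 0) \<and> schwarz_symmetric R u)"
proof -
  interpret nls_nonlinearity f
    using assms(3-7) by unfold_locales
  interpret schwarz_rearrangement R by fact
  interpret schwarz_nls f R by unfold_locales
  \<comment> \<open>Continuity carries the strict inequality at \<open>\<zeta>\<close> to some
    \<open>b\<close> below \<open>\<zeta>\<close>; the threshold is \<open>b\<^sup>2\<close>, which
    makes it strictly less than \<open>\<zeta>\<^sup>2\<close>.\<close>
  have "isCont (\<lambda>t. F t - 2 * real CARD('n) * t\<^sup>2) \<zeta>"
    by (intro continuous_intros F_isCont)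
  then have "\<forall>\<^sub>F t in at \<zeta>. 0 < F t - 2 * real CARD('n) * t\<^sup>2"
    unfolding isCont_def by (rule order_tendstoD(1)) (rule assms(9))
  then obtain d where d: "d > 0"
    and pos: "\<And>t. t \<noteq> \<zeta> \<Longrightarrow> \<bar>t - \<zeta>\<bar> < d \<Longrightarrow> 0 < F t - 2 * real CARD('n) * t\<^sup>2"
    by (auto simp: eventually_at dist_real_def)
  \<comment> \<open>The first entry keeps \<open>b\<close> positive, the second keeps it within
    \<open>d\<close> of \<open>\<zeta>\<close>.\<close>
  define b where "b = max (\<zeta> / 2) (\<zeta> - d / 2)"
  have b: "0 < b" "b < \<zeta>" "\<bar>b - \<zeta>\<bar> < d"
    using d assms(8) by (auto simp: b_def max_def)
  have Fb: "2 * real CARD('n) < F b / b\<^sup>2"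
    using pos[of b] b by (simp add: pos_less_divide_eq)
  have "\<exists>u \<in> mass_sphere m. ereal (energy f u) = ground_energy TYPE('n) f m \<and>
      (\<forall>x. u x > 0) \<and> schwarz_symmetric R u" if m: "b\<^sup>2 < m" for m
  proof -
    have "0 < m" using m zero_le_power2[of b] by linarith
    define a where "a = sqrt m"
    have a: "b < a" "a\<^sup>2 = m" using m \<open>0 < m\<close> by (auto simp: a_def intro: real_less_rsqrt)
    \<comment> \<open>Monotonicity of the quotient passes the inequality from \<open>b\<close> to
      every larger \<open>a\<close>, hence to every mass above the threshold.\<close>
    have "2 * real CARD('n) < F a / a\<^sup>2"
      using Fb monotone_onD[OF mono, of b a] a b by simp
    then have "2 * real CARD('n) * m < F a"
      using a \<open>0 < m\<close> by (simp add: pos_less_divide_eq)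
    moreover have "0 \<le> real CARD('n) * m" using \<open>0 < m\<close> by simp
    ultimately have neg: "CARD('n) * a\<^sup>2 - F a < 0" unfolding a(2) by linarith
    let ?u = "\<lambda>x :: int ^ 'n. if x = 0 then a else 0"
    have u: "?u \<in> mass_sphere m" "energy f ?u < 0"
      using energy_point_mass[of a, where 'n = 'n] neg a b by auto
    obtain w where w: "w \<in> mass_sphere m" "schwarz_symmetric R w"
      and min: "\<And>u :: int ^ 'n \<Rightarrow> real. u \<in> mass_sphere m \<Longrightarrow> energy f w \<le> energy f u"
      using minimiser_exists[OF \<open>0 < m\<close> u] by blast
    have "ground_energy TYPE('n) f m = ereal (energy f w)"
      unfolding ground_energy_def
      by (intro antisym INF_lower INF_greatest) (use w min in auto)
    moreover have "0 < w x" for x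
      using minimiser_pos[OF w(1) \<open>0 < m\<close> _ min] w(2)
      by (simp add: schwarz_symmetric_def admissible_def)
    ultimately show ?thesis using w by metis
  qed
  moreover have "b\<^sup>2 < \<zeta>\<^sup>2" using b by (intro power_strict_mono) auto
  ultimately show ?thesis using zero_le_power2 by blast
qed

end
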